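(* Let $\phi:\mathbb{R}\to\mathbb{R}$. Then $\phi$ satisfies Assumption B (as defined in the context) if one of the following conditions is satisfied. (i) $\phi\in C(\mathbb{R})\cap L_1(\mathbb{R})$ is a symmetric (i.e. $\phi(-x)=\phi(x)$) real-valued function with Fourier transform $\widehat{\phi}(x)\ge 0$ for all $x$, such that there exist $n_0\in\mathbb{N}$ and $C>0$ with $$C(1+|x|^{n_0})^{-1}\le|\widehat{\phi}(x)|\qquad\text{for all }x\in\mathbb{R}.$$ (ii) For every $k\in\mathbb{N}$, $\phi$ is extended sign regular of order $k+2$ on $\mathbb{R}$, and $0<\int_{\mathbb{R}}\phi(x)\,dx<\infty$. (iii) For some $p\in\{0,1,2,\dots\}$, $\phi(x)=x^p$ for $x\in[0,1]$ and $\phi(x)=0$ otherwise (with $x^0=1$).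
   Context: For $a,b\in\mathbb{R}\cup\{-\infty,\infty\}$, $a\le b$, put $\Delta_\phi(x,a,b)=\int_a^b\phi(x-y)\,dy$ if $a\ne b$ and $\Delta_\phi(x,a,a)=\phi(x-a)$ (for $a$ finite). Assumption B: $\phi\in L_1(\mathbb{R})\cap L_2(\mathbb{R})\cap L_\infty(\mathbb{R})$ is piecewise continuous with finitely many jumps, and for every $k\in\mathbb{N}=\{1,2,\dots\}$ and every $-\infty=\tau_0\le 0<\tau_1\le\tau_2\le\dots\le\tau_k<1\le\tau_{k+1}=\infty$ in which at most two subsequent $\tau_i$ are equal (no three of the $\tau_i$ coincide), the functions $x\mapsto\Delta_\phi(x,\tau_0,\tau_1),\ \Delta_\phi(x,\tau_1,\tau_2),\dots,\Delta_\phi(x,\tau_k,\tau_{k+1})$ are linearly independent as elements of $L_2([0,1])$. Extended sign regularity: let $K(x,y)=\phi(x-y)$, assumed sufficiently often differentiable. For $x_1\le\dots\le x_m$ and $y_1\le\dots\le y_m$ let $p_i=\#\{j<i:x_j=x_i\}$, $q_i=\#\{j<i:y_j=y_i\}$, and $K^*(x_1,\dots,x_m;y_1,\dots,y_m)=\det\big(\partial_x^{p_i}\partial_y^{q_j}K(x_i,y_j)\big)_{i,j=1}^m$. Then $\phi$ is extended sign regular of order $r$ on $\mathbb{R}$ if there are signs $\epsilon_1,\dots,\epsilon_r\in\{-1,1\}$ with $\epsilon_mK^*(x_1,\dots,x_m;y_1,\dots,y_m)>0$ for all $m=1,\dots,r$ and all real $x_1\le\dots\le x_m$, $y_1\le\dots\le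 y_m$. *)

theory Defs
  imports "HOL-Analysis.Analysis" "Jordan_Normal_Form.Determinant"
begin

section \<open>Lebesgue spaces of real functions\<close>

text \<open>Elements are representatives; the almost-everywhere identification is made where it
  matters, namely in the vanishing condition of linear independence.\<close>

definition L1_space :: "'a measure \<Rightarrow> ('a \<Rightarrow> real) set" where
  "L1_space M = {f. integrable M f}"

definition L2_space :: "'a measure \<Rightarrow> ('a \<Rightarrow> real) set" where
  "L2_space M = {f \<in> borel_measurable M. integrable M (\<lambda>x. (f x)\<^sup>2)}"

definition Linf_space :: "'a measure \<Rightarrow> ('a \<Rightarrow> real) set" where
  "Linf_space M = {f \<in> borel_measurable M. \<exists>C. AE x in M. \<bar>f x\<bar> \<le> C}"

text \<open>Linear independence of a finite indexed family; two members with different indices that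
  are equal almost everywhere make the family dependent.\<close>

definition L2_independent :: "'a measure \<Rightarrow> 'i set \<Rightarrow> ('i \<Rightarrow> 'a \<Rightarrow> real) \<Rightarrow> bool" where
  "L2_independent M I f \<longleftrightarrow>
     (\<forall>i\<in>I. f i \<in> L2_space M) \<and>
     (\<forall>c. (AE x in M. (\<Sum>i\<in>I. c i * f i x) = 0) \<longrightarrow> (\<forall>i\<in>I. c i = 0))"


section \<open>Assumption B\<close>

definition piecewise_continuous :: "(real \<Rightarrow> real) \<Rightarrow> bool" where
  "piecewise_continuous \<phi> \<longleftrightarrow>
     (\<exists>S. finite S \<and> (\<forall>x. x \<notin> S \<longrightarrow> isCont \<phi> x) \<and>
          (\<forall>x\<in>S. (\<exists>l. (\<phi> \<longlongrightarrow> l) (at_left x)) \<and> (\<exists>r. (\<phi> \<longlongrightarrow> r) (at_right x))))"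

text \<open>The case \<open>a = b\<close> is meant for finite \<open>a\<close> only.\<close>

definition Delta :: "(real \<Rightarrow> real) \<Rightarrow> real \<Rightarrow> ereal \<Rightarrow> ereal \<Rightarrow> real" where
  "Delta \<phi> x a b =
     (if a = b then \<phi> (x - real_of_ereal a) else (LBINT y=a..b. \<phi> (x - y)))"

definition admissible_partition :: "nat \<Rightarrow> (nat \<Rightarrow> ereal) \<Rightarrow> bool" where
  "admissible_partition k \<tau> \<longleftrightarrow>
     \<tau> 0 = -\<infinity> \<and> 0 < \<tau> 1 \<and> (\<forall>i\<in>{1..<k}. \<tau> i \<le> \<tau> (i + 1)) \<and> \<tau> k < 1 \<and> \<tau> (k + 1) = \<infinity> \<and>
     (\<forall>i. i + 2 \<le> k + 1 \<longrightarrow> \<not> (\<tau> i = \<tau> (i + 1) \<and> \<tau> (i + 1) = \<tau> (i + 2)))"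

definition assumption_B :: "(real \<Rightarrow> real) \<Rightarrow> bool" where
  "assumption_B \<phi> \<longleftrightarrow>
     \<phi> \<in> L1_space lborel \<inter> L2_space lborel \<inter> Linf_space lborel \<and>
     piecewise_continuous \<phi> \<and>
     (\<forall>k\<ge>1. \<forall>\<tau>. admissible_partition k \<tau> \<longrightarrow>
        L2_independent (restrict_space lborel {0..1}) {0..k} (\<lambda>j x. Delta \<phi> x (\<tau> j) (\<tau> (j + 1))))"


section \<open>Fourier transform\<close>

definition fourier :: "(real \<Rightarrow> real) \<Rightarrow> real \<Rightarrow> complex" where
  "fourier \<phi> x = (\<integral>t. complex_of_real (\<phi> t) * exp (- (\<i> * of_real (x * t))) \<partial>lborel)"


section \<open>Extended sign regularity\<close>

definition prior_count :: "(nat \<Rightarrow> real) \<Rightarrow> nat \<Rightarrow> nat" where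
  "prior_count x i = card {j. j < i \<and> x j = x i}"

text \<open>Points are indexed from 0: \<open>x 0, \<dots>, x (m - 1)\<close>.\<close>

definition K_star :: "(real \<Rightarrow> real \<Rightarrow> real) \<Rightarrow> nat \<Rightarrow> (nat \<Rightarrow> real) \<Rightarrow> (nat \<Rightarrow> real) \<Rightarrow> real" where
  "K_star K m x y = Determinant.det (Matrix.mat m m (\<lambda>(i, j).
     (deriv ^^ prior_count x i) (\<lambda>s. (deriv ^^ prior_count y j) (\<lambda>t. K s t) (y j)) (x i)))"

text \<open>For order \<open>r\<close> the determinants involve derivatives of \<open>\<phi>\<close> up to order \<open>2 * (r - 1)\<close>,
  attained when all points coincide; these are required to exist.\<close>

definition extended_sign_regular :: "(real \<Rightarrow> real) \<Rightarrow> nat \<Rightarrow> bool" where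
  "extended_sign_regular \<phi> r \<longleftrightarrow>
     (\<forall>n < 2 * (r - 1). \<forall>x. (deriv ^^ n) \<phi> field_differentiable (at x)) \<and>
     (\<exists>\<epsilon> :: nat \<Rightarrow> real. (\<forall>m\<in>{1..r}. \<epsilon> m \<in> {-1, 1}) \<and>
        (\<forall>m\<in>{1..r}. \<forall>x y. mono_on {..<m} x \<and> mono_on {..<m} y \<longrightarrow>
           \<epsilon> m * K_star (\<lambda>s t. \<phi> (s - t)) m x y > 0))"

end

theory Submission
  imports Defs "HOL-Probability.Characteristic_Functions"
    "HOL-Complex_Analysis.Conformal_Mappings" "HOL-Real_Asymp.Real_Asymp"
begin

text \<open>
  On \<open>[0,1]\<close> the functions in question are convolutions of \<open>\<phi>\<close> with the pieces of a partition of
  the line: with the indicator of \<open>(\<tau> j, \<tau> (j+1))\<close>, or with the unit mass at \<open>\<tau> j\<close> when the knot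
  is double. A linear relation between them on \<open>[0,1]\<close> thus says that \<open>\<phi> * \<mu>\<close> vanishes there,
  \<open>\<mu>\<close> being the corresponding combination of pieces. The three classes of \<open>\<phi>\<close> exclude \<open>\<mu> \<noteq> 0\<close>
  for three different reasons.

  \<^item> \<^emph>\<open>Positive Fourier transform.\<close> Only the derivative \<open>\<mu>'\<close> has compact support: it is carried by the
    knots, which lie strictly inside \<open>(0,1)\<close>. The derivative of \<open>\<phi> * \<mu>\<close> is \<open>\<phi> * \<mu>'\<close>, and pairing it
    with \<open>\<mu>'\<close> itself would give \<open>\<integral> \<phi>^ \<bar>\<mu>'^\<bar>\<^sup>2 = 0\<close>, hence \<open>\<mu>' = 0\<close>. To stay with genuine
    functions, both \<open>\<phi> * \<mu>'\<close> and the second factor are averaged over a short interval \<open>[-h,h]\<close>,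
    which multiplies \<open>\<mu>'^\<close> by the transform of a box (\<open>Delta_difference_transform\<close>,
    \<open>vanishing_transform_pairing\<close>). The transform of \<open>\<mu>'\<close> is an exponential polynomial; it vanishes on
    an interval, so everywhere by analytic continuation, and its growth on the imaginary axis shows that
    its coefficients vanish (\<open>exp_cell_coefficients\<close>). What remains is a constant multiple
    of Lebesgue measure, and \<open>\<phi> * 1 = \<integral> \<phi> \<noteq> 0\<close>. The Fourier inversion that this
    needs, and the boundedness of \<open>\<phi>\<close>, come from Gaussian summation: non-negativity of the transform
    and continuity of \<open>\<phi>\<close> at \<open>0\<close> make the transform integrable
    (\<open>nonneg_fourier_integrable\<close>).

  \<^item> \<^emph>\<open>Sign regularity.\<close> The determinants \<open>det (\<phi> (x i - y j))\<close> with increasing \<open>x\<close> and \<open>y\<close> have one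
    strict sign. Integrating \<open>y j\<close> over the \<open>j\<close>-th cell, one column after the other, preserves the sign
    (\<open>mixed_determinant_pos\<close>), so the collocation matrix of the family at any increasing points is
    invertible. Orders one and two, with \<open>\<integral> \<phi> > 0\<close>, make \<open>\<phi>\<close> positive and either strictly log-convex at midpoints,
    which contradicts integrability, or strictly log-concave at midpoints, which forces boundedness.

  \<^item> \<^emph>\<open>Truncated powers.\<close> Immediately to the right of \<open>\<tau> j\<close> the \<open>j\<close>-th function dominates all later
    ones, so the family is triangular.

  The same triangularity argument (\<open>triangular_independence\<close>) also settles the exponential polynomials
  above, with \<open>\<infinity>\<close> in place of a right neighbourhood of a knot.
\<close>

section \<open>Triangular families\<close>

text \<open>Along \<open>F j\<close> the \<open>j\<close>-th function dominates all later ones. If the earlier coefficients are already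
  known to vanish, dividing the relation by \<open>f j\<close> and passing to the limit isolates \<open>c j\<close>. Since the limit
  exists, it is enough that the relation holds frequently; this is what a relation valid almost everywhere
  provides.\<close>
lemma triangular_independence:
  fixes f :: "nat \<Rightarrow> 'a \<Rightarrow> real"
  assumes I: "finite I"
    and freq: "\<And>j. j \<in> I \<Longrightarrow> \<exists>\<^sub>F x in F j. (\<Sum>i\<in>I. c i * f i x) = 0"
    and nz: "\<And>j. j \<in> I \<Longrightarrow> \<forall>\<^sub>F x in F j. f j x \<noteq> 0"
    and dom: "\<And>i j. i \<in> I \<Longrightarrow> j \<in> I \<Longrightarrow> j < i \<Longrightarrow> ((\<lambda>x. f i x / f j x) \<longlongrightarrow> 0) (F j)"
    and "j \<in> I"
  shows "c j = 0"
  using \<open>j \<in> I\<close>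
proof (induction j rule: less_induct)
  case (less j)
  have lim: "((\<lambda>x. c i * (f i x / f j x)) \<longlongrightarrow> (if i = j then c j else 0)) (F j)" if "i \<in> I" for i
  proof (cases i j rule: linorder_cases)
    case less
    then show ?thesis using less.IH that by simp
  next
    case equal
    have "((\<lambda>x. f j x / f j x) \<longlongrightarrow> 1) (F j)"
      by (rule tendsto_eventually) (use nz[OF less.prems] in eventually_elim, simp)
    then have "((\<lambda>x. c j * (f j x / f j x)) \<longlongrightarrow> c j * 1) (F j)"
      by (intro tendsto_intros)
    then show ?thesis using equal by simp
  next
    case greater
    have "((\<lambda>x. c i * (f i x / f j x)) \<longlongrightarrow> c i * 0) (F j)"
      by (intro tendsto_intros dom that less.prems greater)
    then show ?thesis using greater by simp
  qed
  have "((\<lambda>x. \<Sum>i\<in>I. c i * (f i x / f j x)) \<longlongrightarrow> (\<Sum>i\<in>I. if i = j then c j else 0)) (F j)"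
    by (intro tendsto_sum lim)
  also have "(\<Sum>i\<in>I. if i = j then c j else 0) = c j"
    using I less.prems by simp
  also have "(\<lambda>x. \<Sum>i\<in>I. c i * (f i x / f j x)) = (\<lambda>x. (\<Sum>i\<in>I. c i * f i x) / f j x)"
    by (simp add: sum_divide_distrib)
  finally have L: "((\<lambda>x. (\<Sum>i\<in>I. c i * f i x) / f j x) \<longlongrightarrow> c j) (F j)" .
  show "c j = 0"
  proof (rule ccontr)
    assume "c j \<noteq> 0"
    from tendsto_imp_eventually_ne[OF L this]
    have "\<forall>\<^sub>F x in F j. \<not> (\<Sum>i\<in>I. c i * f i x) = 0"
      by eventually_elim auto
    with freq[OF less.prems] show False by (simp add: frequently_def)
  qed
qed

section \<open>Integrals over cells as differences of a primitive\<close>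

text \<open>The primitive of \<open>\<phi>\<close> vanishing at \<open>-\<infinity>\<close>. Extended real arguments let the two unbounded cells be
  treated like the others.\<close>
definition primitive :: "(real \<Rightarrow> real) \<Rightarrow> ereal \<Rightarrow> real" where
  "primitive \<phi> e = (LINT t:{t. ereal t < e}|lborel. \<phi> t)"

lemma ereal_ray_borel [measurable]: "{t. ereal t < e} \<in> sets borel"
  by (cases e) auto

lemma primitive_minfty [simp]: "primitive \<phi> (-\<infinity>) = 0"
  by (simp add: primitive_def set_lebesgue_integral_def)

lemma primitive_infty [simp]: "primitive \<phi> \<infinity> = (\<integral>t. \<phi> t \<partial>lborel)"
  by (simp add: primitive_def set_lebesgue_integral_def)

text \<open>Reflecting the variable by \<open>t = x - y\<close> turns the cell into \<open>(x - b, x - a)\<close>, a difference of two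
  rays up to the single point \<open>x - b\<close>.\<close>
lemma Delta_eq_primitive:
  assumes \<phi>: "integrable lborel \<phi>" and ab: "a < b"
  shows "Delta \<phi> x a b = primitive \<phi> (ereal x - a) - primitive \<phi> (ereal x - b)"
proof -
  have int: "integrable lborel (\<lambda>t. indicator {t. ereal t < e} t *\<^sub>R \<phi> t)" for e
    using \<phi> by (intro integrable_mult_indicator) auto
  have "Delta \<phi> x a b = (\<integral>y. indicator (einterval a b) y * \<phi> (x - y) \<partial>lborel)"
    using less_imp_le[OF ab] less_imp_neq[OF ab] by (simp add: Delta_def interval_lebesgue_integral_def set_lebesgue_integral_def)
  also have "\<dots> = (\<integral>t. indicator (einterval a b) (x - t) * \<phi> t \<partial>lborel)"
    by (subst lborel_integral_real_affine[of "-1" _ x]) auto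
  also have "\<dots> = (\<integral>t. indicator {t. ereal t < ereal x - a} t *\<^sub>R \<phi> t
                    - indicator {t. ereal t < ereal x - b} t *\<^sub>R \<phi> t \<partial>lborel)"
  proof (rule integral_cong_AE)
    have "AE t in lborel. t \<noteq> real_of_ereal (ereal x - b)"
      by (rule AE_lborel_singleton)
    then show "AE t in lborel. indicator (einterval a b) (x - t) * \<phi> t =
        indicator {t. ereal t < ereal x - a} t *\<^sub>R \<phi> t - indicator {t. ereal t < ereal x - b} t *\<^sub>R \<phi> t"
    proof eventually_elim
      case (elim t)
      then show ?case
        using ab by (cases a; cases b) (auto simp: indicator_def einterval_def)
    qed
    show "(\<lambda>t. indicator (einterval a b) (x - t) * \<phi> t) \<in> borel_measurable lborel"
      using borel_measurable_integrable[OF \<phi>] by measurable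
    show "(\<lambda>t. indicator {t. ereal t < ereal x - a} t *\<^sub>R \<phi> t
        - indicator {t. ereal t < ereal x - b} t *\<^sub>R \<phi> t) \<in> borel_measurable lborel"
      by (intro borel_measurable_diff borel_measurable_integrable int)
  qed
  also have "\<dots> = primitive \<phi> (ereal x - a) - primitive \<phi> (ereal x - b)"
    unfolding primitive_def set_lebesgue_integral_def by (rule Bochner_Integration.integral_diff[OF int int])
  finally show ?thesis .
qed

lemma continuous_primitive:
  assumes \<phi>: "integrable lborel \<phi>"
  shows "isCont (\<lambda>u. primitive \<phi> (ereal u)) u"
proof (rule continuous_at_sequentiallyI)
  fix s :: "nat \<Rightarrow> real" assume s: "s \<longlonglongrightarrow> u"
  show "(\<lambda>n. primitive \<phi> (ereal (s n))) \<longlonglongrightarrow> primitive \<phi> (ereal u)"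
    unfolding primitive_def set_lebesgue_integral_def
  proof (rule integral_dominated_convergence[where w = "\<lambda>t. norm (\<phi> t)"])
    have "AE t in lborel. t \<noteq> u" by (rule AE_lborel_singleton)
    then show "AE t in lborel. (\<lambda>n. indicator {t. ereal t < ereal (s n)} t *\<^sub>R \<phi> t)
        \<longlonglongrightarrow> indicator {t. ereal t < ereal u} t *\<^sub>R \<phi> t"
    proof eventually_elim
      case (elim t)
      then consider "t < u" | "u < t" by linarith
      then show ?case
      proof cases
        case 1
        from order_tendstoD(1)[OF s 1]
        have "\<forall>\<^sub>F n in sequentially. indicator {t. ereal t < ereal (s n)} t *\<^sub>R \<phi> t
            = indicator {t. ereal t < ereal u} t *\<^sub>R \<phi> t"
          by eventually_elim (use 1 in auto)
        then show ?thesis by (rule tendsto_eventually)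
      next
        case 2
        from order_tendstoD(2)[OF s 2]
        have "\<forall>\<^sub>F n in sequentially. indicator {t. ereal t < ereal (s n)} t *\<^sub>R \<phi> t
            = indicator {t. ereal t < ereal u} t *\<^sub>R \<phi> t"
          by eventually_elim (use 2 in auto)
        then show ?thesis by (rule tendsto_eventually)
      qed
    qed
  qed (use \<phi> in \<open>auto simp: indicator_def intro!: AE_I2\<close>)
qed

lemma continuous_primitive_shift:
  assumes \<phi>: "integrable lborel \<phi>"
  shows "continuous_on UNIV (\<lambda>x. primitive \<phi> (ereal x - a))"
proof (cases a)
  case (real r)
  have "isCont (\<lambda>x. primitive \<phi> (ereal (x - r))) x" for x
    by (rule isCont_o2[OF _ continuous_primitive[OF \<phi>]]) auto
  then show ?thesis by (simp add: real continuous_on_eq_continuous_at)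
qed auto

lemma continuous_Delta:
  assumes "integrable lborel \<phi>" "continuous_on UNIV \<phi>" "a \<le> b"
  shows "continuous_on UNIV (\<lambda>x. Delta \<phi> x a b)"
proof (cases "a = b")
  case True
  have "continuous_on UNIV (\<lambda>x. \<phi> (x - real_of_ereal a))"
    by (rule continuous_on_compose2[OF assms(2)]) (auto intro!: continuous_intros)
  then show ?thesis using True by (simp add: Delta_def)
next
  case False
  then have "Delta \<phi> x a b = primitive \<phi> (ereal x - a) - primitive \<phi> (ereal x - b)" for x
    using Delta_eq_primitive[OF assms(1)] assms(3) by simp
  then show ?thesis
    by (auto intro!: continuous_on_diff continuous_primitive_shift assms)
qed

lemma Delta_in_L2:
  assumes int: "integrable lborel \<phi>" and M: "\<And>x. \<bar>\<phi> x\<bar> \<le> M" and ab: "a \<le> b"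
  shows "(\<lambda>x. Delta \<phi> x a b) \<in> L2_space (restrict_space lborel {0..1})"
proof -
  have [measurable]: "\<phi> \<in> borel_measurable borel"
    using borel_measurable_integrable[OF int] by simp
  have prim: "(\<lambda>x. primitive \<phi> (ereal x - e)) \<in> borel_measurable borel" for e
    by (intro borel_measurable_continuous_onI continuous_primitive_shift int)
  have prim_le: "\<bar>primitive \<phi> e\<bar> \<le> (\<integral>t. \<bar>\<phi> t\<bar> \<partial>lborel)" for e
  proof -
    have i: "integrable lborel (\<lambda>t. indicator {t. ereal t < e} t * \<phi> t)"
      using integrable_mult_indicator[OF _ int, of "{t. ereal t < e}"] by simp
    have "\<bar>primitive \<phi> e\<bar> \<le> (\<integral>t. \<bar>indicator {t. ereal t < e} t * \<phi> t\<bar> \<partial>lborel)"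
      unfolding primitive_def set_lebesgue_integral_def real_scaleR_def by (rule integral_abs_bound)
    also have "\<dots> \<le> (\<integral>t. \<bar>\<phi> t\<bar> \<partial>lborel)"
      by (intro Bochner_Integration.integral_mono integrable_abs i int) (simp split: split_indicator)
    finally show ?thesis .
  qed
  define B where "B = \<bar>M\<bar> + 2 * (\<integral>t. \<bar>\<phi> t\<bar> \<partial>lborel)"
  have meas: "(\<lambda>x. Delta \<phi> x a b) \<in> borel_measurable borel"
  proof (cases "a = b")
    case False
    then have "(\<lambda>x. Delta \<phi> x a b) = (\<lambda>x. primitive \<phi> (ereal x - a) - primitive \<phi> (ereal x - b))"
      using ab by (intro ext Delta_eq_primitive[OF int]) simp
    then show ?thesis by (auto intro!: borel_measurable_diff prim)
  qed (simp add: Delta_def)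
  have bound: "\<bar>Delta \<phi> x a b\<bar> \<le> B" for x
  proof (cases "a = b")
    case True
    have "0 \<le> (\<integral>t. \<bar>\<phi> t\<bar> \<partial>lborel)" by (rule Bochner_Integration.integral_nonneg) simp
    moreover have "Delta \<phi> x a b = \<phi> (x - real_of_ereal a)" using True by (simp add: Delta_def)
    ultimately show ?thesis using M[of "x - real_of_ereal a"] unfolding B_def by linarith
  next
    case False
    then show ?thesis
      using ab prim_le[of "ereal x - a"] prim_le[of "ereal x - b"]
      by (simp add: Delta_eq_primitive[OF int] B_def)
  qed
  have fin: "finite_measure (restrict_space lborel {0..1::real})"
    by (rule finite_measureI) (simp add: emeasure_restrict_space space_restrict_space)
  have sq: "(Delta \<phi> x a b)\<^sup>2 \<le> B\<^sup>2" for x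
    using bound[of x] by (metis abs_ge_zero power2_abs power_mono)
  have "integrable (restrict_space lborel {0..1}) (\<lambda>x. (Delta \<phi> x a b)\<^sup>2)"
    by (rule finite_measure.integrable_const_bound[OF fin, where B = "B\<^sup>2"])
       (use meas sq in \<open>auto intro!: measurable_restrict_space1\<close>)
  then show ?thesis
    using meas by (auto simp: L2_space_def intro!: measurable_restrict_space1)
qed

section \<open>Reduction to linear independence\<close>

text \<open>For a bounded integrable \<open>\<phi>\<close> every membership in Assumption B is automatic, also that of the cell
  functions in \<open>L\<^sub>2\<close>; the vanishing of the coefficients is what depends on the class of \<open>\<phi>\<close>.\<close>
lemma assumption_B_I:
  assumes int: "integrable lborel \<phi>" and M: "\<And>x. \<bar>\<phi> x\<bar> \<le> M" and pc: "piecewise_continuous \<phi>"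
    and ind: "\<And>k \<tau> c j. \<lbrakk>1 \<le> k; admissible_partition k \<tau>;
        AE x in lborel. x \<in> {0..1} \<longrightarrow> (\<Sum>j\<in>{0..k}. c j * Delta \<phi> x (\<tau> j) (\<tau> (j + 1))) = 0;
        j \<le> k\<rbrakk> \<Longrightarrow> c j = 0"
  shows "assumption_B \<phi>"
proof -
  have [measurable]: "\<phi> \<in> borel_measurable borel"
    using borel_measurable_integrable[OF int] by simp
  have "integrable lborel (\<lambda>x. (\<phi> x)\<^sup>2)"
  proof (rule Bochner_Integration.integrable_bound)
    show "integrable lborel (\<lambda>x. M * \<bar>\<phi> x\<bar>)" using int by simp
    have "(\<phi> x)\<^sup>2 \<le> M * \<bar>\<phi> x\<bar>" for x
      using mult_right_mono[OF M[of x] abs_ge_zero[of "\<phi> x"]] by (simp add: power2_eq_square)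
    then show "AE x in lborel. norm ((\<phi> x)\<^sup>2) \<le> norm (M * \<bar>\<phi> x\<bar>)"
      by (intro AE_I2) (metis abs_ge_self abs_power2 order_trans real_norm_def)
  qed simp
  moreover have "\<tau> j \<le> \<tau> (j + 1)" if "admissible_partition k \<tau>" "j \<le> k" for k \<tau> j
    using that by (cases "j = 0"; cases "j = k") (auto simp: admissible_partition_def)
  ultimately have "\<phi> \<in> L1_space lborel \<inter> L2_space lborel \<inter> Linf_space lborel"
    and mono: "\<And>k \<tau> j. admissible_partition k \<tau> \<Longrightarrow> j \<le> k \<Longrightarrow> \<tau> j \<le> \<tau> (j + 1)"
    using int by (auto simp: L1_space_def L2_space_def Linf_space_def intro!: exI[of _ M] AE_I2 M)
  moreover have "L2_independent (restrict_space lborel {0..1}) {0..k} (\<lambda>j x. Delta \<phi> x (\<tau> j) (\<tau> (j + 1)))"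
    if "1 \<le> k" "admissible_partition k \<tau>" for k \<tau>
    unfolding L2_independent_def
  proof (intro conjI ballI allI impI)
    fix j assume "j \<in> {0..k}"
    then show "(\<lambda>x. Delta \<phi> x (\<tau> j) (\<tau> (j + 1))) \<in> L2_space (restrict_space lborel {0..1})"
      by (intro Delta_in_L2[OF int M] mono[OF that(2)]) auto
  next
    fix c j
    assume "AE x in restrict_space lborel {0..1}. (\<Sum>j\<in>{0..k}. c j * Delta \<phi> x (\<tau> j) (\<tau> (j + 1))) = 0"
      and j: "j \<in> {0..k}"
    then have "AE x in lborel. x \<in> {0..1} \<longrightarrow> (\<Sum>j\<in>{0..k}. c j * Delta \<phi> x (\<tau> j) (\<tau> (j + 1))) = 0"
      by (subst (asm) AE_restrict_space_iff) auto
    from ind[OF that this] j show "c j = 0" by simp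
  qed
  ultimately show ?thesis using pc by (auto simp: assumption_B_def)
qed

text \<open>This extracts concrete points from a relation that holds only almost everywhere.\<close>
lemma AE_infinite:
  fixes a b :: real
  assumes ae: "AE x in lborel. x \<in> {a..b} \<longrightarrow> P x" and ab: "a < b"
  shows "infinite {x \<in> {a..b}. P x}"
proof
  let ?Z = "{x \<in> {a..b}. P x}"
  assume fin: "finite ?Z"
  then have "?Z \<in> null_sets lborel" by (rule finite_imp_null_set_lborel)
  then have "AE x in lborel. x \<notin> ?Z" by (rule AE_not_in)
  with ae have "AE x in lborel. x \<notin> {a..b}" by eventually_elim auto
  then have "{a..b} \<in> null_sets lborel" by (subst AE_iff_null_sets) auto
  then show False using ab by (simp add: null_sets_def)
qed

lemma partition_mono_step: "admissible_partition k \<tau> \<Longrightarrow> j \<le> k \<Longrightarrow> \<tau> j \<le> \<tau> (Suc j)"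
  by (cases "j = 0"; cases "j = k") (auto simp: admissible_partition_def)

lemma partition_mono: "admissible_partition k \<tau> \<Longrightarrow> i \<le> j \<Longrightarrow> j \<le> Suc k \<Longrightarrow> \<tau> i \<le> \<tau> j"
proof (induction j)
  case (Suc j)
  then show ?case
    by (metis Suc_leD Suc_le_mono le_Suc_eq order.refl order.trans partition_mono_step)
qed simp

lemma partition_inner:
  assumes "admissible_partition k \<tau>" "1 \<le> j" "j \<le> k"
  obtains t where "\<tau> j = ereal t" "0 < t" "t < 1"
proof -
  have "\<tau> 1 \<le> \<tau> j" "\<tau> j \<le> \<tau> k" using assms by (auto intro!: partition_mono)
  moreover have "0 < \<tau> 1" "\<tau> k < 1" using assms by (auto simp: admissible_partition_def)
  ultimately have "0 < \<tau> j" "\<tau> j < 1" by (metis order.strict_trans2, metis order.strict_trans1)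
  then show ?thesis using that by (cases "\<tau> j") auto
qed

text \<open>A double knot is an inner one, and the cell after it is a proper interval: otherwise three
  knots would coincide.\<close>
lemma partition_double:
  assumes p: "admissible_partition k \<tau>" and "j \<le> k" "\<tau> j = \<tau> (Suc j)"
  shows "1 \<le> j" "j < k" "\<tau> (Suc j) < \<tau> (Suc (Suc j))"
proof -
  have inner: "\<bar>\<tau> i\<bar> \<noteq> \<infinity>" if "1 \<le> i" "i \<le> k" for i by (rule partition_inner[OF p that]) simp
  have "\<tau> 0 = -\<infinity>" "\<tau> (Suc k) = \<infinity>" using p by (auto simp: admissible_partition_def)
  show "1 \<le> j"
  proof (rule ccontr)
    assume "\<not> 1 \<le> j"
    then have "j = 0" by simp
    then have "\<tau> 1 = -\<infinity>" using assms(3) \<open>\<tau> 0 = -\<infinity>\<close> by simp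
    with p show False by (auto simp: admissible_partition_def)
  qed
  show "j < k"
  proof (rule ccontr)
    assume "\<not> j < k"
    then have "\<tau> j = \<infinity>" using assms(2,3) \<open>\<tau> (Suc k) = \<infinity>\<close> by (metis le_neq_implies_less)
    with inner[OF \<open>1 \<le> j\<close> assms(2)] show False by simp
  qed
  note j = \<open>1 \<le> j\<close> \<open>j < k\<close>
  have "\<tau> (Suc j) \<noteq> \<tau> (Suc (Suc j))"
    using p j assms(3) by (auto simp: admissible_partition_def)
  then show "\<tau> (Suc j) < \<tau> (Suc (Suc j))"
    using partition_mono_step[OF p, of "Suc j"] j by (simp add: less_le)
qed

section \<open>Truncated powers\<close>

lemma truncated_power_primitive:
  fixes p :: nat
  assumes \<phi>: "\<And>x. \<phi> x = (if x \<in> {0..1} then x ^ p else (0::real))"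
  shows "u \<le> 1 \<Longrightarrow> primitive \<phi> (ereal u) = (max u 0) ^ Suc p / Suc p"
    and "primitive \<phi> \<infinity> = 1 / Suc p" and "integrable lborel \<phi>"
proof -
  have "\<phi> = (\<lambda>x. indicator {0..1} x *\<^sub>R x ^ p)"
    by (auto simp: \<phi> fun_eq_iff)
  moreover have "set_integrable lborel {0..1} (\<lambda>x::real. x ^ p)"
    by (intro borel_integrable_atLeastAtMost' continuous_intros)
  ultimately show "integrable lborel \<phi>" by (simp add: set_integrable_def)
  have pw: "(\<integral>x. indicator {0..b} x *\<^sub>R x ^ p \<partial>lborel) = b ^ Suc p / Suc p" if "0 \<le> b" for b :: real
    using integral_power[of 0 b p] that by (simp add: mult.commute)
  show "primitive \<phi> \<infinity> = 1 / Suc p"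
    using pw[of 1] \<open>\<phi> = _\<close> by simp
  assume u: "u \<le> 1"
  have "primitive \<phi> (ereal u) = (\<integral>x. indicator {0..max u 0} x *\<^sub>R x ^ p \<partial>lborel)"
    unfolding primitive_def set_lebesgue_integral_def
  proof (rule integral_cong_AE)
    have "AE t in lborel. t \<noteq> max u 0"
      by (rule AE_lborel_singleton)
    then show "AE t in lborel. indicat_real {t. ereal t < ereal u} t *\<^sub>R \<phi> t = indicat_real {0..max u 0} t *\<^sub>R t ^ p"
      by eventually_elim (use u in \<open>auto simp: \<phi> indicator_def\<close>)
    show "(\<lambda>t. indicat_real {t. ereal t < ereal u} t *\<^sub>R \<phi> t) \<in> borel_measurable lborel"
      using borel_measurable_integrable[OF \<open>integrable lborel \<phi>\<close>] by measurable
  qed simp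
  also have "\<dots> = (max u 0) ^ Suc p / Suc p" by (rule pw) simp
  finally show "primitive \<phi> (ereal u) = (max u 0) ^ Suc p / Suc p" .
qed

lemma AE_imp_frequently_at_right:
  fixes t b :: real
  assumes ae: "AE x in lborel. x \<in> {a..b} \<longrightarrow> P x" and t: "a \<le> t" "t < b"
  shows "\<exists>\<^sub>F x in at_right t. P x"
proof (rule ccontr)
  assume "\<not> ?thesis"
  then have "\<forall>\<^sub>F x in at_right t. \<not> P x" by (simp add: frequently_def)
  then obtain d where d: "t < d" "\<And>y. t < y \<Longrightarrow> y < d \<Longrightarrow> \<not> P y"
    by (auto simp: eventually_at_right_field)
  have "AE x in lborel. x \<notin> {t<..<min d b}"
    using ae by eventually_elim (use d t in auto)
  then have "{t<..<min d b} \<in> null_sets lborel"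
    by (subst AE_iff_null_sets) auto
  then show False using d t by (simp add: null_sets_def min_def split: if_splits)
qed

text \<open>To the right of \<open>s j\<close>, the \<open>j\<close>-th function is \<open>(x - s j) ^ (p + 1) / (p + 1)\<close> for a simple knot and
  \<open>(x - s j) ^ p\<close> for a double one, while the later functions still vanish. The only exception is the function
  following a double knot: it starts at the same point, but with one more power of \<open>x - s j\<close>. The cell
  \<open>(-\<infinity>, \<tau> 1)\<close> has no left end point; its function is a positive constant to the right of \<open>0\<close>, so
  \<open>s 0 = 0\<close> serves as its starting point.\<close>
lemma truncated_power_independent:
  assumes \<phi>: "\<And>x. \<phi> x = (if x \<in> {0..1} then x ^ p else (0::real))"
    and part: "admissible_partition k \<tau>"
    and ae: "AE x in lborel. x \<in> {0..1} \<longrightarrow> (\<Sum>j\<in>{0..k}. c j * Delta \<phi> x (\<tau> j) (\<tau> (j + 1))) = 0"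
    and j: "j \<le> k"
  shows "c j = 0"
proof -
  note prim = truncated_power_primitive[OF \<phi>]
  define f where "f i x = Delta \<phi> x (\<tau> i) (\<tau> (i + 1))" for i x
  define s where "s i = (if i = 0 then 0 else real_of_ereal (\<tau> i))" for i
  have \<tau>s: "\<tau> i = ereal (s i)" "0 < s i" "s i < 1" if "1 \<le> i" "i \<le> k" for i
  proof -
    obtain t where "\<tau> i = ereal t" "0 < t" "t < 1" by (rule partition_inner[OF part \<open>1 \<le> i\<close> \<open>i \<le> k\<close>])
    then show "\<tau> i = ereal (s i)" "0 < s i" "s i < 1" using that by (auto simp: s_def)
  qed
  have s01: "0 \<le> s i" "s i < 1" if "i \<le> k" for i
  proof -
    show "0 \<le> s i" using \<tau>s(2)[of i] that by (cases "i = 0") (simp_all add: s_def)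
    show "s i < 1" using \<tau>s(3)[of i] that by (cases "i = 0") (simp_all add: s_def)
  qed
  have ends: "\<tau> 0 = -\<infinity>" "\<tau> (Suc k) = \<infinity>"
    using part by (auto simp: admissible_partition_def)
  have prim0: "primitive \<phi> (ereal x - \<tau> i) = 0" if "x < 1" "ereal x \<le> \<tau> i" "1 \<le> i" "i \<le> Suc k" for x i
  proof (cases "i = Suc k")
    case False
    then have "1 \<le> i" "i \<le> k" using that by auto
    from \<tau>s[OF this] that show ?thesis by (simp add: prim(1) max_def)
  qed (simp add: ends)
  have zero: "f i x = 0" if "1 \<le> i" "i \<le> k" "x < 1" "ereal x < \<tau> i" for i x
  proof (cases "\<tau> i = \<tau> (Suc i)")
    case True
    then have "f i x = \<phi> (x - s i)" using that by (simp add: f_def Delta_def s_def)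
    then show ?thesis using that \<tau>s[of i] by (simp add: \<phi>)
  next
    case False
    then have "\<tau> i < \<tau> (Suc i)" using partition_mono_step[OF part that(2)] by simp
    then show ?thesis
      using that by (simp add: f_def Delta_eq_primitive[OF prim(3)] prim0)
  qed
  have lead: "\<forall>\<^sub>F x in at_right (s i). s i < x \<and> x < 1 \<and>
      f i x = (if \<tau> i = \<tau> (Suc i) then (x - s i) ^ p else if i = 0 then 1 / Suc p else (x - s i) ^ Suc p / Suc p)
      \<and> (\<tau> i < \<tau> (Suc i) \<longrightarrow> ereal x < \<tau> (Suc i))" if i: "i \<le> k" for i
  proof -
    have "\<forall>\<^sub>F x in at_right (s i). \<tau> i < \<tau> (Suc i) \<longrightarrow> ereal x < \<tau> (Suc i)"
    proof (cases "i = k \<or> \<not> \<tau> i < \<tau> (Suc i)")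
      case False
      then have that: "\<tau> i < \<tau> (Suc i)" and "i \<noteq> k" by auto
      with i have ik: "1 \<le> Suc i" "Suc i \<le> k" by auto
      have "s i < s (Suc i)"
      proof (cases "i = 0")
        case True
        then show ?thesis using \<tau>s(2)[OF ik] by (simp add: s_def)
      next
        case False
        then have "ereal (s i) < ereal (s (Suc i))" using that \<tau>s(1)[OF ik] \<tau>s(1)[of i] i by simp
        then show ?thesis by simp
      qed
      then show ?thesis
        using \<tau>s[OF ik] eventually_at_right_less[of "s i"] order_tendstoD(2)[OF tendsto_ident_at, of "s i" "s (Suc i)"]
        by simp
    qed (auto simp: ends)
    moreover have "\<forall>\<^sub>F x in at_right (s i). x < 1"
      using order_tendstoD(2)[OF tendsto_ident_at, of "s i" 1] s01[OF i] by simp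
    ultimately show ?thesis using eventually_at_right_less[of "s i"]
    proof eventually_elim
      case (elim x)
      show ?case
      proof (cases "\<tau> i = \<tau> (Suc i)")
        case True
        from partition_double[OF part i True] have "1 \<le> i" by simp
        from \<tau>s[OF this i] elim True show ?thesis by (simp add: f_def Delta_def \<phi>)
      next
        case False
        then have lt: "\<tau> i < \<tau> (Suc i)" using partition_mono_step[OF part i] by simp
        with elim have x: "ereal x < \<tau> (Suc i)" by simp
        have "f i x = primitive \<phi> (ereal x - \<tau> i)"
          using lt x i elim by (simp add: f_def Delta_eq_primitive[OF prim(3)] prim0)
        also have "\<dots> = (if i = 0 then 1 / Suc p else (x - s i) ^ Suc p / Suc p)"
        proof (cases "i = 0")
          case False
          then show ?thesis using \<tau>s[of i] i elim by (simp add: prim(1) max_def)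
        qed (use prim(2) in \<open>simp add: ends\<close>)
        finally show ?thesis using False lt x elim by simp
      qed
    qed
  qed
  show ?thesis
  proof (rule triangular_independence[where I = "{0..k}" and F = "\<lambda>i. at_right (s i)" and f = f])
    fix i assume "i \<in> {0..k}"
    then show "\<exists>\<^sub>F x in at_right (s i). (\<Sum>i\<in>{0..k}. c i * f i x) = 0"
      unfolding f_def using s01[of i] by (intro AE_imp_frequently_at_right[OF ae]) auto
  next
    fix i assume "i \<in> {0..k}"
    then have "i \<le> k" by simp
    from lead[OF this] show "\<forall>\<^sub>F x in at_right (s i). f i x \<noteq> 0"
      by eventually_elim auto
  next
    fix i j assume ij: "i \<in> {0..k}" "j \<in> {0..k}" "j < i"
    then have j: "j \<le> k" and i: "i \<le> k" by auto
    show "((\<lambda>x. f i x / f j x) \<longlongrightarrow> 0) (at_right (s j))"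
    proof (cases "\<tau> j = \<tau> (Suc j) \<and> i = Suc j")
      case False
      have "\<forall>\<^sub>F x in at_right (s j). f i x = 0"
      proof (cases "\<tau> j = \<tau> (Suc j)")
        case True
        from partition_double[OF part j True] have jj: "1 \<le> j" "j < k" "\<tau> (Suc j) < \<tau> (Suc (Suc j))" by auto
        have "\<tau> (Suc j) = ereal (s j)" using \<tau>s[OF jj(1) j] True by simp
        then have sj: "s (Suc j) = s j" by (simp add: s_def)
        have "\<tau> (Suc (Suc j)) \<le> \<tau> i" using False True ij i by (intro partition_mono[OF part]) auto
        have "Suc j \<le> k" using jj by simp
        from lead[OF this, unfolded sj] show ?thesis
          by eventually_elim (use jj \<open>\<tau> (Suc (Suc j)) \<le> \<tau> i\<close> ij i in \<open>auto intro!: zero elim: order.strict_trans2\<close>)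
      next
        case False
        then have lt: "\<tau> j < \<tau> (Suc j)" using partition_mono_step[OF part j] by simp
        have "\<tau> (Suc j) \<le> \<tau> i" using ij i by (intro partition_mono[OF part]) auto
        from lead[OF j] show ?thesis
          by eventually_elim (use lt \<open>\<tau> (Suc j) \<le> \<tau> i\<close> ij i in \<open>auto intro!: zero elim: order.strict_trans2\<close>)
      qed
      then have "\<forall>\<^sub>F x in at_right (s j). f i x / f j x = 0" by eventually_elim simp
      then show ?thesis by (rule tendsto_eventually)
    next
      case True
      from partition_double[OF part j] True have jj: "1 \<le> j" "j < k" "\<tau> (Suc j) < \<tau> (Suc (Suc j))" by auto
      have "\<tau> (Suc j) = ereal (s j)" using \<tau>s[OF jj(1) j] True by simp
      then have sj: "s (Suc j) = s j" by (simp add: s_def)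
      have ev: "\<forall>\<^sub>F x in at_right (s j). (x - s j) / Suc p = f i x / f j x"
        using lead[OF i, unfolded conjunct2[OF True] sj] lead[OF j]
        by eventually_elim (use True jj in auto)
      have "((\<lambda>x. (x - s j) / Suc p) \<longlongrightarrow> (s j - s j) / Suc p) (at_right (s j))"
        by (intro tendsto_intros) auto
      then show ?thesis using tendsto_cong[OF ev] by simp
    qed
  qed (use j in auto)
qed

lemma truncated_power_assumption_B:
  assumes \<phi>: "\<And>x. \<phi> x = (if x \<in> {0..1} then x ^ p else (0::real))"
  shows "assumption_B \<phi>"
proof (rule assumption_B_I)
  show "integrable lborel \<phi>" by (rule truncated_power_primitive(3)[OF \<phi>])
  show "\<bar>\<phi> x\<bar> \<le> 1" for x by (auto simp: \<phi> power_le_one)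
  show "piecewise_continuous \<phi>"
    unfolding piecewise_continuous_def
  proof (intro exI[of _ "{0, 1}"] conjI allI ballI impI)
    have inner: "\<forall>\<^sub>F y in nhds x. \<phi> y = y ^ p" if "0 < x" "x < 1" for x
      using eventually_nhds_in_open[of "{0<..<1}" x] that by (auto simp: \<phi> elim!: eventually_mono)
    have outer: "\<forall>\<^sub>F y in nhds x. \<phi> y = 0" if "x < 0 \<or> 1 < x" for x
      using eventually_nhds_in_open[of "- {0..1}" x] that by (auto simp: \<phi> open_Compl elim!: eventually_mono)
    fix x :: real
    assume x: "x \<notin> {0, 1}"
    show "isCont \<phi> x"
    proof (cases "0 < x \<and> x < 1")
      case True
      then show ?thesis using isCont_cong[OF inner[of x]] by simp
    next
      case False
      then have "x < 0 \<or> 1 < x" using x by auto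
      then show ?thesis using isCont_cong[OF outer[of x]] by simp
    qed
  next
    fix x :: real assume x: "x \<in> {0, 1}"
    have pw: "((\<lambda>y. y ^ p) \<longlongrightarrow> x ^ p) F" if "F \<le> at x" for F
      using tendsto_mono[OF that] by (intro tendsto_intros) (auto intro: tendsto_mono[OF that] tendsto_ident_at)
    have r0: "\<forall>\<^sub>F y in at_right 0. \<phi> y = y ^ p" 
      using eventually_at_right_real[of 0 1] by (auto simp: \<phi> elim!: eventually_mono)
    have l1: "\<forall>\<^sub>F y in at_left 1. \<phi> y = y ^ p" 
      using eventually_at_left_real[of 0 1] by (auto simp: \<phi> elim!: eventually_mono)
    have l0: "\<forall>\<^sub>F y in at_left 0. \<phi> y = 0" 
      using eventually_at_left_real[of "-1" 0] by (auto simp: \<phi> elim!: eventually_mono)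
    have r1: "\<forall>\<^sub>F y in at_right 1. \<phi> y = 0" 
      using eventually_at_right_real[of 1 2] by (auto simp: \<phi> elim!: eventually_mono)
    have le: "at_left x \<le> at x" "at_right x \<le> at x" by (auto intro: at_le)
    show "\<exists>l. (\<phi> \<longlongrightarrow> l) (at_left x)"
      using x pw[OF le(1)] tendsto_cong[OF l1] tendsto_cong[OF l0] by (auto intro: tendsto_eventually[OF l0])
    show "\<exists>l. (\<phi> \<longlongrightarrow> l) (at_right x)"
      using x pw[OF le(2)] tendsto_cong[OF r0] by (auto intro: tendsto_eventually[OF r1])
  qed auto
qed (rule truncated_power_independent[OF \<phi>])

section \<open>Sign regular functions\<close>

text \<open>The set over which the \<open>j\<close>-th shift parameter ranges: a point for a double knot.\<close>
definition cell :: "(nat \<Rightarrow> ereal) \<Rightarrow> nat \<Rightarrow> real set" where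
  "cell \<tau> j = (if \<tau> j = \<tau> (Suc j) then {real_of_ereal (\<tau> j)} else einterval (\<tau> j) (\<tau> (Suc j)))"

lemma cell_less:
  assumes p: "admissible_partition k \<tau>" and j: "j < k"
    and x: "x \<in> cell \<tau> j" and y: "y \<in> cell \<tau> (Suc j)"
  shows "x < y"
proof -
  obtain t where t: "\<tau> (Suc j) = ereal t" by (rule partition_inner[OF p, of "Suc j"]) (use j in auto)
  show ?thesis
  proof (cases "\<tau> j = \<tau> (Suc j)")
    case True
    then have "\<tau> (Suc j) < \<tau> (Suc (Suc j))" using partition_double[OF p _ True] j by simp
    then show ?thesis using x y t True by (auto simp: cell_def einterval_def split: if_splits)
  next
    case False
    then have "x < t" using x t by (simp add: cell_def einterval_def)
    moreover have "t \<le> y"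
    proof (cases "\<tau> (Suc j) = \<tau> (Suc (Suc j))")
      case True
      then have "y = real_of_ereal (\<tau> (Suc j))" using y by (simp add: cell_def)
      then show ?thesis by (simp add: t)
    qed (use y t in \<open>simp add: cell_def einterval_def\<close>)
    ultimately show ?thesis by simp
  qed
qed

lemma strictly_increasing_upto:
  fixes y :: "nat \<Rightarrow> 'a::order"
  assumes "\<And>j. j < k \<Longrightarrow> y j < y (Suc j)" "i < j" "j \<le> k"
  shows "y i < y j"
  using assms(2,3)
proof (induction j)
  case (Suc j)
  then show ?case using assms(1)[of j] by (cases "i = j") (auto intro: less_trans)
qed simp

text \<open>Expansion along column \<open>n\<close> makes the determinant a linear function of that column with cofactors
  that do not involve it, so integration passes from the column to the determinant.\<close>
lemma det_replace_column:
  fixes B :: "real \<Rightarrow> real mat"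
  assumes A: "A \<in> carrier_mat m m" and B: "\<And>t. B t \<in> carrier_mat m m" and n: "n < m"
    and same: "\<And>t i j. i < m \<Longrightarrow> j < m \<Longrightarrow> j \<noteq> n \<Longrightarrow> B t $$ (i,j) = A $$ (i,j)"
    and int: "\<And>i. i < m \<Longrightarrow> set_integrable M S (\<lambda>t. B t $$ (i,n))"
    and col: "\<And>i. i < m \<Longrightarrow> A $$ (i,n) = (LINT t:S|M. B t $$ (i,n))"
  shows "set_integrable M S (\<lambda>t. Determinant.det (B t))"
    and "Determinant.det A = (LINT t:S|M. Determinant.det (B t))"
proof -
  have cof: "cofactor (B t) i n = cofactor A i n" if "i < m" for t i
  proof -
    have "mat_delete (B t) i n = mat_delete A i n"
      using A B[of t] that n
      by (intro eq_matI) (auto simp: mat_delete_def same)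
    then show ?thesis by (simp add: cofactor_def)
  qed
  have detB: "Determinant.det (B t) = (\<Sum>i<m. B t $$ (i,n) * cofactor A i n)" for t
    using laplace_expansion_column[OF B n, of t] cof by simp
  have ind: "indicator S t *\<^sub>R Determinant.det (B t) =
      (\<Sum>i<m. (indicator S t *\<^sub>R B t $$ (i,n)) * cofactor A i n)" for t
    unfolding detB by (simp add: sum_distrib_left mult.assoc)
  have i: "integrable M (\<lambda>t. (indicator S t *\<^sub>R B t $$ (i,n)) * cofactor A i n)" if "i < m" for i
    using int[OF that] unfolding set_integrable_def by (rule integrable_mult_left)
  show "set_integrable M S (\<lambda>t. Determinant.det (B t))"
    unfolding set_integrable_def ind by (rule Bochner_Integration.integrable_sum) (use i in auto)
  have "(LINT t:S|M. Determinant.det (B t)) =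
      (\<Sum>i<m. (\<integral>t. (indicator S t *\<^sub>R B t $$ (i,n)) * cofactor A i n \<partial>M))"
    unfolding set_lebesgue_integral_def ind by (rule Bochner_Integration.integral_sum) (use i in auto)
  also have "\<dots> = (\<Sum>i<m. A $$ (i,n) * cofactor A i n)"
    using int by (intro sum.cong refl) (simp add: col set_lebesgue_integral_def set_integrable_def)
  also have "\<dots> = Determinant.det A"
    using laplace_expansion_column[OF A n] by simp
  finally show "Determinant.det A = (LINT t:S|M. Determinant.det (B t))" ..
qed

lemma set_integral_pos_einterval:
  fixes f :: "real \<Rightarrow> real"
  assumes int: "set_integrable lborel (einterval a b) f" and ab: "a < b"
    and pos: "\<And>t. t \<in> einterval a b \<Longrightarrow> 0 < f t"
  shows "0 < (LINT t:einterval a b|lborel. f t)"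
proof -
  let ?g = "\<lambda>t. indicator (einterval a b) t *\<^sub>R f t"
  have i: "integrable lborel ?g" using int by (simp add: set_integrable_def)
  have nn: "0 \<le> ?g t" for t using pos[of t] by (auto simp: indicator_def)
  have "integral\<^sup>L lborel ?g \<noteq> 0"
  proof
    assume "integral\<^sup>L lborel ?g = 0"
    with integral_nonneg_eq_0_iff_AE[OF i] nn have "AE t in lborel. ?g t = 0" by simp
    then have "AE t in lborel. t \<notin> einterval a b"
      by eventually_elim (use pos in \<open>force simp: indicator_def\<close>)
    then have null: "einterval a b \<in> null_sets lborel" by (subst AE_iff_null_sets) auto
    obtain c where c: "a < ereal c" "ereal c < b" using ereal_dense2[OF ab] by blast
    then have "einterval a b \<noteq> {}" by (auto simp: einterval_def)
    moreover have "open (einterval a b)" by simp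
    ultimately show False
      using null open_not_negligible null_sets_completionI negligible_iff_null_sets by blast
  qed
  moreover have "0 \<le> integral\<^sup>L lborel ?g" using nn by (intro Bochner_Integration.integral_nonneg)
  ultimately show ?thesis by (simp add: set_lebesgue_integral_def)
qed

lemma reflected_set_integrable:
  fixes \<phi> :: "real \<Rightarrow> real"
  assumes "integrable lborel \<phi>"
  shows "set_integrable lborel (einterval a b) (\<lambda>t. \<phi> (x - t))"
proof -
  have "integrable lborel (\<lambda>t. \<phi> (x - t))"
    using lborel_integrable_real_affine[OF assms, of "-1" x] by simp
  then show ?thesis unfolding set_integrable_def by (intro integrable_mult_indicator) auto
qed

text \<open>The first \<open>n\<close> columns are already integrated over their cells, the others still carry a parameter in
  their own cell. Passing from \<open>n\<close> to \<open>n + 1\<close> integrates a positive function over cell \<open>n\<close>, or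
  evaluates it at the double knot. At \<open>n = 0\<close> the parameters increase strictly because they lie in
  consecutive cells.\<close>
lemma mixed_determinant_pos:
  fixes \<phi> :: "real \<Rightarrow> real"
  assumes int: "integrable lborel \<phi>" and p: "admissible_partition k \<tau>"
    and sr: "\<And>y. strict_mono_on {..<Suc k} y \<Longrightarrow>
        0 < \<epsilon> * Determinant.det (Matrix.mat (Suc k) (Suc k) (\<lambda>(i, j). \<phi> (x i - y j)))"
    and "n \<le> Suc k" and "\<And>j. n \<le> j \<Longrightarrow> j \<le> k \<Longrightarrow> y j \<in> cell \<tau> j"
  shows "0 < \<epsilon> * Determinant.det (Matrix.mat (Suc k) (Suc k)
      (\<lambda>(i, j). if j < n then Delta \<phi> (x i) (\<tau> j) (\<tau> (Suc j)) else \<phi> (x i - y j)))"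
  using assms(4,5)
proof (induction n arbitrary: y)
  case 0
  have step: "y j < y (Suc j)" if "j < k" for j
    by (rule cell_less[OF p that]) (use that in \<open>simp_all add: 0\<close>)
  have "strict_mono_on {..<Suc k} y"
  proof (rule strict_mono_onI)
    fix i j assume "j \<in> {..<Suc k}" "i < j"
    then show "y i < y j" using strictly_increasing_upto[of k y, OF step] by simp
  qed
  from sr[OF this] show ?case by simp
next
  case (Suc n)
  let ?m = "Suc k"
  define A where "A = Matrix.mat ?m ?m
      (\<lambda>(i, j). if j < Suc n then Delta \<phi> (x i) (\<tau> j) (\<tau> (Suc j)) else \<phi> (x i - y j))"
  define B where "B t = Matrix.mat ?m ?m
      (\<lambda>(i, j). if j < n then Delta \<phi> (x i) (\<tau> j) (\<tau> (Suc j)) else \<phi> (x i - (y(n := t)) j))" for t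
  have n: "n < ?m" using Suc.prems by simp
  have B_pos: "0 < \<epsilon> * Determinant.det (B t)" if "t \<in> cell \<tau> n" for t
    unfolding B_def
  proof (rule Suc.IH)
    show "n \<le> Suc k" using Suc.prems(1) by simp
    show "(y(n := t)) j \<in> cell \<tau> j" if "n \<le> j" "j \<le> k" for j
      using that \<open>t \<in> cell \<tau> n\<close> Suc.prems(2)[of j] by (cases "j = n") simp_all
  qed
  have "0 < \<epsilon> * Determinant.det A"
  proof (cases "\<tau> n = \<tau> (Suc n)")
    case True
    have "A = B (real_of_ereal (\<tau> n))"
      unfolding A_def B_def
      by (rule cong_mat) (use True in \<open>auto simp: Delta_def less_Suc_eq\<close>)
    then show ?thesis using B_pos True by (simp add: cell_def)
  next
    case False
    have lt: "\<tau> n < \<tau> (Suc n)" using False partition_mono_step[OF p, of n] n by simp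
    let ?S = "einterval (\<tau> n) (\<tau> (Suc n))"
    have cell: "cell \<tau> n = ?S" using False by (simp add: cell_def)
    have AB: "A \<in> carrier_mat ?m ?m" "\<And>t. B t \<in> carrier_mat ?m ?m"
      by (simp_all add: A_def B_def)
    have same: "B t $$ (i, j) = A $$ (i, j)" if "i < ?m" "j < ?m" "j \<noteq> n" for t i j
      using that by (auto simp: A_def B_def less_Suc_eq)
    have Bn: "B t $$ (i, n) = \<phi> (x i - t)" if "i < ?m" for t i
      using that n by (simp add: B_def)
    have colint: "set_integrable lborel ?S (\<lambda>t. B t $$ (i, n))" if "i < ?m" for i
      using reflected_set_integrable[OF int] that by (simp add: Bn)
    have col: "A $$ (i, n) = (LINT t:?S|lborel. B t $$ (i, n))" if "i < ?m" for i
      using that n lt False less_imp_le[OF lt]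
      by (simp add: Bn A_def Delta_def interval_lebesgue_integral_def)
    note dets = det_replace_column[where M = lborel and S = ?S, OF AB n same colint col]
    have "0 < (LINT t:?S|lborel. \<epsilon> * Determinant.det (B t))"
      by (rule set_integral_pos_einterval[OF _ lt])
         (use dets(1) B_pos cell in \<open>auto intro!: set_integrable_mult_right\<close>)
    then show ?thesis using dets(2) by simp
  qed
  then show ?case unfolding A_def .
qed

lemma mat_column_independent:
  fixes A :: "real mat"
  assumes A: "A \<in> carrier_mat m m" and det: "Determinant.det A \<noteq> 0"
    and zero: "\<And>i. i < m \<Longrightarrow> (\<Sum>j<m. c j * A $$ (i, j)) = 0" and "j < m"
  shows "c j = 0"
proof -
  define v where "v = Matrix.vec m c"
  have "A *\<^sub>v v = 0\<^sub>v m"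
    using A zero by (intro eq_vecI) (auto simp: v_def scalar_prod_def mult.commute atLeast0LessThan)
  moreover have "v \<in> carrier_vec m" by (simp add: v_def)
  ultimately have "v = 0\<^sub>v m" using det_0_iff_vec_prod_zero[OF A] det by blast
  then show ?thesis using \<open>j < m\<close> by (metis index_vec index_zero_vec(1) v_def)
qed

lemma AE_increasing_points:
  fixes a b :: real
  assumes ae: "AE x in lborel. x \<in> {a..b} \<longrightarrow> P x" and ab: "a < b"
  shows "\<exists>x :: nat \<Rightarrow> real. strict_mono_on {..<m} x \<and> (\<forall>i<m. x i \<in> {a..b} \<and> P (x i))"
proof -
  let ?Z = "{x \<in> {a..b}. P x}"
  have "infinite ?Z" by (rule AE_infinite[OF ae ab])
  then obtain T where T: "T \<subseteq> ?Z" "finite T" "card T = m"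
    using infinite_arbitrarily_large by blast
  define xs where "xs = sorted_list_of_set T"
  have xs: "sorted_wrt (<) xs" "length xs = m" "set xs = T"
    using T by (auto simp: xs_def)
  show ?thesis
  proof (intro exI[of _ "nth xs"] conjI allI impI)
    show "strict_mono_on {..<m} (nth xs)"
      by (rule strict_mono_onI) (use sorted_wrt_nth_less[OF xs(1)] xs(2) in simp)
    show "xs ! i \<in> {a..b}" "P (xs ! i)" if "i < m" for i
      using that xs T nth_mem[of i xs] by auto
  qed
qed

lemma not_integrable_bounded_below:
  fixes f :: "real \<Rightarrow> real"
  assumes "integrable lborel f" "0 < c"
  shows "\<exists>x>a. f x < c" "\<exists>x<a. f x < c"
proof -
  have *: "\<exists>x>a. f x < c" if f: "integrable lborel f" for f :: "real \<Rightarrow> real" and a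
  proof (rule ccontr)
    assume "\<not> ?thesis"
    then have ge: "c \<le> f x" if "x > a" for x using that by force
    have "integrable lborel (\<lambda>x. c * indicator {a<..} x)"
      by (rule Bochner_Integration.integrable_bound[OF f])
         (use ge \<open>0 < c\<close> in \<open>force simp: indicator_def intro!: AE_I2\<close>)+
    then have "integrable lborel (indicator {a<..} :: real \<Rightarrow> real)"
      using \<open>0 < c\<close> by simp
    then have fin: "emeasure lborel {a<..} < \<infinity>" by (simp add: integrable_indicator_iff)
    have "of_nat n \<le> emeasure lborel {a<..}" for n
    proof -
      have "emeasure lborel {a<..<a + real n} \<le> emeasure lborel {a<..}" by (rule emeasure_mono) auto
      then show ?thesis by (simp add: ennreal_of_nat_eq_real_of_nat)
    qed
    then have "(SUP n. of_nat n) \<le> emeasure lborel {a<..}" by (intro SUP_least)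
    then have "emeasure lborel {a<..} = \<infinity>"
      unfolding ennreal_SUP_of_nat_eq_top by (simp add: top_unique)
    with fin show False by simp
  qed
  show "\<exists>x>a. f x < c" by (rule *[OF assms(1)])
  have "integrable lborel (\<lambda>x. f (- x))"
    using lborel_integrable_real_affine[OF assms(1), of "-1" 0] by simp
  from *[OF this, of "-a"] obtain x where "-a < x" "f (-x) < c" by blast
  then show "\<exists>x<a. f x < c" by (intro exI[of _ "-x"]) auto
qed

text \<open>Sign regularity of order \<open>m\<close> exactly, without confluent nodes and hence without derivatives.\<close>
definition strictly_sign_regular :: "(real \<Rightarrow> real) \<Rightarrow> nat \<Rightarrow> real \<Rightarrow> bool" where
  "strictly_sign_regular \<phi> m \<epsilon> \<longleftrightarrow> \<epsilon> \<in> {-1, 1} \<and>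
     (\<forall>x y. strict_mono_on {..<m} x \<longrightarrow> strict_mono_on {..<m} y \<longrightarrow>
        0 < \<epsilon> * Determinant.det (Matrix.mat m m (\<lambda>(i, j). \<phi> (x i - y j))))"

text \<open>For distinct nodes all the counts \<open>prior_count\<close> vanish, and the confluent determinant is the
  ordinary one.\<close>
lemma extended_imp_strictly_sign_regular:
  assumes "extended_sign_regular \<phi> r" and m: "m \<in> {1..r}"
  shows "\<exists>\<epsilon>. strictly_sign_regular \<phi> m \<epsilon>"
proof -
  obtain \<epsilon> :: "nat \<Rightarrow> real" where \<epsilon>: "\<forall>m\<in>{1..r}. \<epsilon> m \<in> {-1, 1}"
    and K: "\<forall>m\<in>{1..r}. \<forall>x y. mono_on {..<m} x \<and> mono_on {..<m} y \<longrightarrow>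
           \<epsilon> m * K_star (\<lambda>s t. \<phi> (s - t)) m x y > 0"
    using assms by (auto simp: extended_sign_regular_def)
  have cnt: "prior_count x i = 0" if "strict_mono_on {..<m} x" "i < m" for x i
  proof -
    have "\<not> (j < i \<and> x j = x i)" for j
      using strict_mono_onD[OF that(1), of j i] that(2) by auto
    then show ?thesis by (simp add: prior_count_def)
  qed
  have "0 < \<epsilon> m * Determinant.det (Matrix.mat m m (\<lambda>(i, j). \<phi> (x i - y j)))"
    if x: "strict_mono_on {..<m} x" and y: "strict_mono_on {..<m} y" for x y
  proof -
    have "\<epsilon> m * K_star (\<lambda>s t. \<phi> (s - t)) m x y > 0"
      using K m strict_mono_on_imp_mono_on[OF x] strict_mono_on_imp_mono_on[OF y] by blast
    also have "K_star (\<lambda>s t. \<phi> (s - t)) m x y = Determinant.det (Matrix.mat m m (\<lambda>(i, j). \<phi> (x i - y j)))"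
      unfolding K_star_def
      by (intro arg_cong[where f = Determinant.det] cong_mat) (simp_all add: cnt[OF x] cnt[OF y])
    finally show ?thesis .
  qed
  then show ?thesis using \<epsilon> m unfolding strictly_sign_regular_def by blast
qed

text \<open>The midpoint inequality excludes local minima, so \<open>\<phi>\<close> is quasi-concave: on an interval it is
  at least the smaller of its end values. By integrability \<open>\<phi>\<close> falls below \<open>\<phi> 0\<close> on either side of \<open>0\<close>, and by
  quasi-concavity it never rises above \<open>\<phi> 0\<close> again beyond those points.\<close>
lemma bounded_if_no_local_min:
  fixes \<phi> :: "real \<Rightarrow> real"
  assumes cont: "continuous_on UNIV \<phi>" and int: "integrable lborel \<phi>" and pos: "\<And>x. 0 < \<phi> x"
    and mid: "\<And>x h. 0 < h \<Longrightarrow> \<phi> (x - h) * \<phi> (x + h) < (\<phi> x)\<^sup>2"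
  shows "\<exists>M. \<forall>x. \<bar>\<phi> x\<bar> \<le> M"
proof -
  have no_min: False if "a < c" "c < b" "\<And>x. x \<in> {a..b} \<Longrightarrow> \<phi> c \<le> \<phi> x" for a b c
  proof -
    \<comment> \<open>the largest step for which both neighbours of \<open>c\<close> remain in \<open>[a,b]\<close>\<close>
    define h where "h = min (c - a) (b - c)"
    have h: "0 < h" "c - h \<in> {a..b}" "c + h \<in> {a..b}" using that by (auto simp: h_def)
    have "(\<phi> c)\<^sup>2 \<le> \<phi> (c - h) * \<phi> (c + h)"
      unfolding power2_eq_square using that(3)[OF h(2)] that(3)[OF h(3)] pos[of c]
      by (intro mult_mono) auto
    with mid[OF h(1), of c] show False by simp
  qed
  have quasi: "min (\<phi> a) (\<phi> b) \<le> \<phi> x" if x: "a \<le> x" "x \<le> b" for a b x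
  proof (rule ccontr)
    assume less: "\<not> ?thesis"
    obtain c where c: "c \<in> {a..b}" "\<And>x. x \<in> {a..b} \<Longrightarrow> \<phi> c \<le> \<phi> x"
      using continuous_attains_inf[of "{a..b}" \<phi>] x continuous_on_subset[OF cont, of "{a..b}"] by auto
    have "\<phi> c \<le> \<phi> x" using c x by simp
    then have "c \<noteq> a" "c \<noteq> b" using less by auto
    then show False using no_min[of a c b] c by auto
  qed
  obtain b where b: "0 < b" "\<phi> b < \<phi> 0" using not_integrable_bounded_below(1)[OF int pos[of 0]] by blast
  obtain a where a: "a < 0" "\<phi> a < \<phi> 0" using not_integrable_bounded_below(2)[OF int pos[of 0]] by blast
  have right: "\<phi> x \<le> \<phi> 0" if "b \<le> x" for x using quasi[of 0 b x] b that by auto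
  have left: "\<phi> x \<le> \<phi> 0" if "x \<le> a" for x using quasi[of x a 0] a that by auto
  have "\<exists>c\<in>{a..b}. \<forall>x\<in>{a..b}. \<phi> x \<le> \<phi> c"
    using a b continuous_on_subset[OF cont, of "{a..b}"] by (intro continuous_attains_sup) auto
  then obtain c where c: "\<And>x. x \<in> {a..b} \<Longrightarrow> \<phi> x \<le> \<phi> c" by blast
  show ?thesis
  proof (intro exI[of _ "\<phi> c"] allI)
    fix x
    have "\<phi> 0 \<le> \<phi> c" using c[of 0] a b by simp
    then show "\<bar>\<phi> x\<bar> \<le> \<phi> c"
      using c[of x] right[of x] left[of x] pos[of x] by fastforce
  qed
qed

lemma det_two:
  "Determinant.det (Matrix.mat 2 2 (\<lambda>(i, j). g i j)) = g 0 0 * g 1 1 - g 0 1 * (g 1 0 :: real)"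
proof -
  let ?A = "Matrix.mat 2 2 (\<lambda>(i, j). g i j)"
  have A: "?A \<in> carrier_mat 2 2" by simp
  have del: "Determinant.det (mat_delete ?A 0 0) = g 1 1" "Determinant.det (mat_delete ?A 1 0) = g 0 1"
    by (subst det_single; simp add: mat_delete_def)+
  have "{..<2} = {0, 1 :: nat}" by auto
  then have "Determinant.det ?A = ?A $$ (0, 0) * cofactor ?A 0 0 + ?A $$ (1, 0) * cofactor ?A 1 0"
    using laplace_expansion_column[OF A, of 0] by simp
  also have "cofactor ?A 0 0 = g 1 1" unfolding cofactor_def del by simp
  also have "cofactor ?A 1 0 = - g 0 1" unfolding cofactor_def del by simp
  finally show ?thesis by (simp add: mult.commute)
qed

text \<open>Order one fixes the sign of \<open>\<phi>\<close>, which is that of its integral. Order two at the nodes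
  \<open>x, x + h\<close> and \<open>0, h\<close> compares \<open>(\<phi> x)\<^sup>2\<close> with \<open>\<phi> (x - h) * \<phi> (x + h)\<close>. If the product were always the larger,
  then \<open>\<phi> h + \<phi> (- h) \<ge> 2 * \<phi> 0\<close> for all \<open>h\<close> by the inequality of the means, against integrability.\<close>
lemma sign_regular_assumption_B:
  assumes sr: "\<And>k. 1 \<le> k \<Longrightarrow> extended_sign_regular \<phi> (k + 2)"
    and int: "integrable lborel \<phi>" and ipos: "0 < (\<integral>x. \<phi> x \<partial>lborel)"
  shows "assumption_B \<phi>"
proof -
  have sr3: "extended_sign_regular \<phi> 3" using sr[of 1] by (simp add: numeral_3_eq_3)
  obtain \<epsilon>\<^sub>1 where \<epsilon>1: "strictly_sign_regular \<phi> 1 \<epsilon>\<^sub>1"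
    using extended_imp_strictly_sign_regular[OF sr3, of 1] by auto
  obtain \<epsilon>\<^sub>2 where \<epsilon>2: "strictly_sign_regular \<phi> 2 \<epsilon>\<^sub>2"
    using extended_imp_strictly_sign_regular[OF sr3, of 2] by auto
  have diff: "(deriv ^^ 0) \<phi> field_differentiable (at x)" for x
  proof -
    have "\<forall>n < 2 * (3 - 1). \<forall>x. (deriv ^^ n) \<phi> field_differentiable (at x)"
      using sr3 unfolding extended_sign_regular_def by blast
    from this[rule_format, of 0 x] show ?thesis by simp
  qed
  have cont: "isCont \<phi> x" for x
    using field_differentiable_imp_continuous_at[OF diff] by simp
  then have conton: "continuous_on UNIV \<phi>" by (simp add: continuous_on_eq_continuous_at)
  have sgn: "0 < \<epsilon>\<^sub>1 * \<phi> x" for x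
  proof -
    have "0 < \<epsilon>\<^sub>1 * Determinant.det (Matrix.mat 1 1 (\<lambda>(i, j). \<phi> (x - 0)))"
      by (rule \<epsilon>1[unfolded strictly_sign_regular_def, THEN conjunct2, rule_format])
         (auto simp: strict_mono_on_def)
    then show ?thesis by (simp add: det_single)
  qed
  have pos: "0 < \<phi> x" for x
  proof (rule ccontr)
    assume "\<not> 0 < \<phi> x"
    then have "\<epsilon>\<^sub>1 = -1" using sgn[of x] \<epsilon>1 by (auto simp: strictly_sign_regular_def)
    then have le: "\<phi> y \<le> 0" for y using sgn[of y] by simp
    have "(\<integral>x. \<phi> x \<partial>lborel) \<le> (\<integral>x. 0 \<partial>(lborel :: real measure))"
      by (rule Bochner_Integration.integral_mono[OF int]) (auto simp: le)
    with ipos show False by simp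
  qed
  have two: "0 < \<epsilon>\<^sub>2 * ((\<phi> x)\<^sup>2 - \<phi> (x - h) * \<phi> (x + h))" if "0 < h" for x h
  proof -
    let ?x = "\<lambda>i::nat. if i = 0 then x else x + h" and ?y = "\<lambda>i::nat. if i = 0 then 0 else h"
    have "strict_mono_on {..<2} ?x" "strict_mono_on {..<2} ?y"
      using that by (auto simp: strict_mono_on_def less_2_cases_iff)
    with \<epsilon>2 have "0 < \<epsilon>\<^sub>2 * Determinant.det (Matrix.mat 2 2 (\<lambda>(i, j). \<phi> (?x i - ?y j)))"
      unfolding strictly_sign_regular_def by blast
    then show ?thesis unfolding det_two by (simp add: power2_eq_square)
  qed
  have "\<epsilon>\<^sub>2 \<noteq> -1"
  proof
    assume e: "\<epsilon>\<^sub>2 = -1"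
    have "2 * \<phi> 0 \<le> \<phi> h + \<phi> (- h)" if h: "0 < h" for h
    proof -
      have "(\<phi> 0)\<^sup>2 < \<phi> h * \<phi> (- h)" using two[OF h, of 0] e by (simp add: mult.commute)
      then have "(2 * \<phi> 0)\<^sup>2 \<le> 4 * (\<phi> h * \<phi> (- h))" by (simp add: power_mult_distrib)
      also have "\<dots> \<le> (\<phi> h + \<phi> (- h))\<^sup>2"
        using zero_le_power2[of "\<phi> h - \<phi> (- h)"] by (simp add: power2_eq_square algebra_simps)
      finally show ?thesis by (rule power2_le_imp_le) (use pos[of h] pos[of "-h"] in simp)
    qed
    moreover have "integrable lborel (\<lambda>h. \<phi> h + \<phi> (- h))"
      using int lborel_integrable_real_affine[OF int, of "-1" 0] by simp
    ultimately show False
      using not_integrable_bounded_below(1)[of "\<lambda>h. \<phi> h + \<phi> (- h)" "2 * \<phi> 0" 0] pos[of 0] by force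
  qed
  with \<epsilon>2 have e2: "\<epsilon>\<^sub>2 = 1" by (auto simp: strictly_sign_regular_def)
  have mid: "\<phi> (x - h) * \<phi> (x + h) < (\<phi> x)\<^sup>2" if "0 < h" for x h
    using two[OF that, of x] e2 by simp
  obtain M where M: "\<And>x. \<bar>\<phi> x\<bar> \<le> M"
    using bounded_if_no_local_min[OF conton int pos mid] by blast
  show ?thesis
  proof (rule assumption_B_I[OF int M])
    show "piecewise_continuous \<phi>"
      unfolding piecewise_continuous_def by (rule exI[of _ "{}"]) (simp add: cont)
  next
    fix k \<tau> c j
    assume k: "1 \<le> k" and p: "admissible_partition k \<tau>" and j: "j \<le> k"
      and ae: "AE x in lborel. x \<in> {0..1} \<longrightarrow> (\<Sum>j\<in>{0..k}. c j * Delta \<phi> x (\<tau> j) (\<tau> (j + 1))) = 0"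
    obtain \<epsilon> where \<epsilon>: "strictly_sign_regular \<phi> (Suc k) \<epsilon>"
      using extended_imp_strictly_sign_regular[OF sr[OF k], of "Suc k"] by auto
    obtain x :: "nat \<Rightarrow> real" where x: "strict_mono_on {..<Suc k} x"
      and zero: "\<And>i. i < Suc k \<Longrightarrow> (\<Sum>j\<in>{0..k}. c j * Delta \<phi> (x i) (\<tau> j) (\<tau> (j + 1))) = 0"
      using AE_increasing_points[OF ae, of "Suc k"] by auto
    have "0 < \<epsilon> * Determinant.det (Matrix.mat (Suc k) (Suc k) (\<lambda>(i, j). \<phi> (x i - y j)))"
      if "strict_mono_on {..<Suc k} y" for y
      using \<epsilon> x that unfolding strictly_sign_regular_def by blast
    from mixed_determinant_pos[OF int p this, of "Suc k" "\<lambda>_. 0"]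
    have "0 < \<epsilon> * Determinant.det (Matrix.mat (Suc k) (Suc k)
        (\<lambda>(i, j). if j < Suc k then Delta \<phi> (x i) (\<tau> j) (\<tau> (Suc j)) else \<phi> (x i - 0)))"
      by simp
    then have nz: "Determinant.det (Matrix.mat (Suc k) (Suc k)
        (\<lambda>(i, j). if j < Suc k then Delta \<phi> (x i) (\<tau> j) (\<tau> (Suc j)) else \<phi> (x i - 0))) \<noteq> 0"
      by (metis less_irrefl mult_zero_right)
    show "c j = 0"
      by (rule mat_column_independent[OF _ nz])
         (use zero j in \<open>auto simp: atLeast0AtMost lessThan_Suc_atMost\<close>)
  qed
qed

section \<open>Fourier inversion by Gaussian summation\<close>

lemma std_normal_density_le_1: "std_normal_density x \<le> 1"
proof -
  have "1 \<le> sqrt (2 * pi)" using pi_gt3 by simp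
  then have "1 / sqrt (2 * pi) * exp (- x\<^sup>2 / 2) \<le> 1 * 1"
    by (intro mult_mono) auto
  then show ?thesis by (simp add: std_normal_density_def)
qed

lemma std_normal_density_mult_le_1:
  "\<bar>y\<bar> * std_normal_density y \<le> 1"
proof -
  have "\<bar>y\<bar> \<le> 1 + y\<^sup>2 / 2"
    using zero_le_power2[of "\<bar>y\<bar> - 1"] by (simp add: power2_eq_square algebra_simps)
  also have "\<dots> \<le> exp (y\<^sup>2 / 2)" by simp
  finally have "\<bar>y\<bar> * exp (- y\<^sup>2 / 2) \<le> exp (y\<^sup>2 / 2) * exp (- y\<^sup>2 / 2)"
    by (intro mult_right_mono) auto
  then have 1: "\<bar>y\<bar> * exp (- y\<^sup>2 / 2) \<le> 1" by (simp add: exp_add[symmetric])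
  have "1 \<le> sqrt (2 * pi)" using pi_gt3 by simp
  then have "(1 / sqrt (2 * pi)) * (\<bar>y\<bar> * exp (- y\<^sup>2 / 2)) \<le> 1 * 1"
    using 1 by (intro mult_mono) auto
  then show ?thesis by (simp add: std_normal_density_def mult_ac)
qed

lemma integrable_mult_bounded:
  fixes f g :: "real \<Rightarrow> 'a :: {real_normed_field, banach, second_countable_topology}"
  assumes f: "integrable lborel f" and g: "g \<in> borel_measurable borel" and B: "\<And>x. norm (g x) \<le> B"
  shows "integrable lborel (\<lambda>x. f x * g x)"
proof (rule Bochner_Integration.integrable_bound)
  show "integrable lborel (\<lambda>x. norm (f x) * B)" using f by simp
  show "(\<lambda>x. f x * g x) \<in> borel_measurable lborel"
    using borel_measurable_integrable[OF f] g by simp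
  have "0 \<le> B" using B[of undefined] norm_ge_zero order_trans by blast
  then show "AE x in lborel. norm (f x * g x) \<le> norm (norm (f x) * B)"
    by (intro AE_I2) (simp add: norm_mult mult_left_mono[OF B])
qed

text \<open>Since \<open>\<phi>\<close> may be unbounded, it is split at distance \<open>d\<close> from \<open>x\<close>. The near part \<open>a\<close> is bounded, and
  after rescaling dominated convergence applies with the Gaussian as majorant. For the far part \<open>b\<close> the kernel
  itself is bounded by \<open>1 / d\<close> uniformly in \<open>n\<close>, so \<open>\<bar>\<phi>\<bar> / d\<close> is a majorant.\<close>
lemma gaussian_mollification:
  fixes \<phi> :: "real \<Rightarrow> real"
  assumes int: "integrable lborel \<phi>" and cont: "isCont \<phi> x"
  shows "(\<lambda>n. \<integral>t. \<phi> t * (real (Suc n) * std_normal_density (real (Suc n) * (x - t))) \<partial>lborel) \<longlonglongrightarrow> \<phi> x"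
proof -
  have [measurable]: "\<phi> \<in> borel_measurable borel"
    using borel_measurable_integrable[OF int] by simp
  define k where "k n t = real (Suc n) * std_normal_density (real (Suc n) * (x - t))" for n t
  have k0: "0 \<le> k n t" for n t by (simp add: k_def)
  have kle: "norm (k n t) \<le> real (Suc n)" for n t
    using mult_left_mono[OF std_normal_density_le_1, of "real (Suc n)" "real (Suc n) * (x - t)"] k0[of n t]
    by (simp add: k_def)
  have [measurable]: "k n \<in> borel_measurable borel" for n unfolding k_def by measurable
  obtain d where d: "0 < d" "\<And>t. \<bar>t - x\<bar> < d \<Longrightarrow> \<bar>\<phi> t\<bar> \<le> \<bar>\<phi> x\<bar> + 1"
  proof -
    from cont[unfolded continuous_at_eps_delta, rule_format, of 1]
    obtain d where "0 < d" "\<forall>t. dist t x < d \<longrightarrow> dist (\<phi> t) (\<phi> x) < 1" by auto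
    then show ?thesis by (intro that[of d]) (force simp: dist_real_def)+
  qed
  define a where "a t = indicator {x-d<..<x+d} t * \<phi> t" for t
  define b where "b t = \<phi> t - a t" for t
  have [measurable]: "a \<in> borel_measurable borel" "b \<in> borel_measurable borel"
    unfolding a_def b_def by measurable
  have inta: "integrable lborel a"
    using integrable_mult_indicator[OF _ int, of "{x-d<..<x+d}"] by (simp add: a_def[abs_def])
  have intb: "integrable lborel b"
    unfolding b_def using int inta by simp
  have a_bound: "\<bar>a t\<bar> \<le> \<bar>\<phi> x\<bar> + 1" for t
    using d(2)[of t] by (auto simp: a_def indicator_def abs_if)
  have cont_a: "isCont a x"
  proof -
    have "\<forall>\<^sub>F t in nhds x. a t = \<phi> t"
      using eventually_nhds_in_open[of "{x-d<..<x+d}" x] d(1)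
      by (auto simp: a_def elim!: eventually_mono)
    from isCont_cong[OF this] cont show ?thesis by simp
  qed
  have ax: "a x = \<phi> x" using d(1) by (simp add: a_def)
  have "(\<lambda>n. \<integral>z. a (x - z / real (Suc n)) * std_normal_density z \<partial>lborel)
      \<longlonglongrightarrow> (\<integral>z. \<phi> x * std_normal_density z \<partial>lborel)"
  proof (rule integral_dominated_convergence[where w = "\<lambda>z. (\<bar>\<phi> x\<bar> + 1) * std_normal_density z"])
    show "integrable lborel (\<lambda>z. (\<bar>\<phi> x\<bar> + 1) * std_normal_density z)" by simp
    show "AE z in lborel. norm (a (x - z / real (Suc n)) * std_normal_density z) \<le> (\<bar>\<phi> x\<bar> + 1) * std_normal_density z" for n
      using a_bound by (intro AE_I2) (simp add: abs_mult mult_right_mono)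
    show "AE z in lborel. (\<lambda>n. a (x - z / real (Suc n)) * std_normal_density z) \<longlonglongrightarrow> \<phi> x * std_normal_density z"
    proof (rule AE_I2)
      fix z
      have "(\<lambda>n. x - z / real (Suc n)) \<longlonglongrightarrow> x" by real_asymp
      from isCont_tendsto_compose[OF cont_a this]
      have "(\<lambda>n. a (x - z / real (Suc n))) \<longlonglongrightarrow> \<phi> x" by (simp add: ax)
      then show "(\<lambda>n. a (x - z / real (Suc n)) * std_normal_density z) \<longlonglongrightarrow> \<phi> x * std_normal_density z"
        by (rule tendsto_mult_right)
    qed
  qed auto
  moreover have "(\<integral>z. a (x - z / real (Suc n)) * std_normal_density z \<partial>lborel) = (\<integral>t. a t * k n t \<partial>lborel)" for n
  proof -
    define N where "N = real (Suc n)"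
    have N: "0 < N" by (simp add: N_def)
    have kn: "k n (x + - 1 / N * z) = N * std_normal_density z" for z
      unfolding k_def N_def[symmetric] using N by simp
    have "(\<integral>t. a t * k n t \<partial>lborel) = \<bar>- 1 / N\<bar> *\<^sub>R (\<integral>z. a (x + - 1 / N * z) * k n (x + - 1 / N * z) \<partial>lborel)"
      using N by (intro lborel_integral_real_affine) simp
    also have "(\<integral>z. a (x + - 1 / N * z) * k n (x + - 1 / N * z) \<partial>lborel)
        = (\<integral>z. N * (a (x - z / N) * std_normal_density z) \<partial>lborel)"
      unfolding kn by (simp add: mult_ac)
    also have "\<dots> = N * (\<integral>z. a (x - z / N) * std_normal_density z \<partial>lborel)"
      by (rule integral_mult_right_zero)
    finally show ?thesis unfolding N_def[symmetric] using N by simp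
  qed
  moreover have "(\<integral>z. \<phi> x * std_normal_density z \<partial>lborel) = \<phi> x" by simp
  ultimately have lim_a: "(\<lambda>n. \<integral>t. a t * k n t \<partial>lborel) \<longlonglongrightarrow> \<phi> x" by simp
  have "(\<lambda>n. \<integral>t. b t * k n t \<partial>lborel) \<longlonglongrightarrow> (\<integral>t. 0 \<partial>(lborel :: real measure))"
  proof (rule integral_dominated_convergence[where w = "\<lambda>t. \<bar>\<phi> t\<bar> * (1 / d)"])
    show "integrable lborel (\<lambda>t. \<bar>\<phi> t\<bar> * (1 / d))" using int by simp
    have far: "b t = 0 \<or> d \<le> \<bar>x - t\<bar> \<and> b t = \<phi> t" for t
      by (auto simp: b_def a_def indicator_def)
    show "AE t in lborel. norm (b t * k n t) \<le> \<bar>\<phi> t\<bar> * (1 / d)" for n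
    proof (rule AE_I2)
      fix t
      consider "b t = 0" | "d \<le> \<bar>x - t\<bar>" "b t = \<phi> t" using far by blast
      then show "norm (b t * k n t) \<le> \<bar>\<phi> t\<bar> * (1 / d)"
      proof cases
        case 2
        have "d * k n t \<le> \<bar>x - t\<bar> * k n t" using 2 k0 by (intro mult_right_mono)
        also have "\<dots> = \<bar>real (Suc n) * (x - t)\<bar> * std_normal_density (real (Suc n) * (x - t))"
          by (simp add: k_def abs_mult)
        also have "\<dots> \<le> 1" by (rule std_normal_density_mult_le_1)
        finally have "k n t \<le> 1 / d" using d(1) by (simp add: field_simps)
        then show ?thesis using 2 k0[of n t] mult_left_mono[of "k n t" "1 / d" "\<bar>\<phi> t\<bar>"] by (simp add: abs_mult)
      qed (use d in simp)
    qed
    show "AE t in lborel. (\<lambda>n. b t * k n t) \<longlonglongrightarrow> 0"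
    proof (rule AE_I2)
      fix t
      consider "b t = 0" | "d \<le> \<bar>x - t\<bar>" using far by blast
      then show "(\<lambda>n. b t * k n t) \<longlonglongrightarrow> 0"
      proof cases
        case 2
        define y where "y = (x - t)\<^sup>2"
        have "0 < y" using 2 d(1) by (auto simp: y_def)
        then have "(\<lambda>n. real (Suc n) * (1 / sqrt (2 * pi) * exp (- ((real (Suc n))\<^sup>2 * y) / 2))) \<longlonglongrightarrow> 0"
          by real_asymp
        then have "(\<lambda>n. k n t) \<longlonglongrightarrow> 0"
          by (simp add: k_def std_normal_density_def y_def power_mult_distrib)
        then show ?thesis by (rule tendsto_mult_right_zero)
      qed simp
    qed
  qed auto
  then have lim_b: "(\<lambda>n. \<integral>t. b t * k n t \<partial>lborel) \<longlonglongrightarrow> 0" by simp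
  have "(\<integral>t. \<phi> t * k n t \<partial>lborel) = (\<integral>t. a t * k n t \<partial>lborel) + (\<integral>t. b t * k n t \<partial>lborel)" for n
  proof -
    have "integrable lborel (\<lambda>t. a t * k n t)" "integrable lborel (\<lambda>t. b t * k n t)"
      by (rule integrable_mult_bounded[OF inta _ kle] integrable_mult_bounded[OF intb _ kle]; simp)+
    then show ?thesis
      by (subst Bochner_Integration.integral_add[symmetric]) (auto simp: b_def algebra_simps)
  qed
  with tendsto_add[OF lim_a lim_b] show ?thesis unfolding k_def by simp
qed

lemma gaussian_fourier_integral:
  assumes N: "0 < N"
  shows "(\<integral>\<xi>. iexp (\<xi> * y) * of_real (exp (- (\<xi> / N)\<^sup>2 / 2)) \<partial>lborel)
    = complex_of_real (2 * pi * (N * std_normal_density (N * y)))"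
proof -
  have "complex_of_real (exp (- (N * y)\<^sup>2 / 2)) = char std_normal_distribution (N * y)"
    by (simp add: char_std_normal_distribution)
  also have "\<dots> = (\<integral>w. std_normal_density w *\<^sub>R iexp (N * y * w) \<partial>lborel)"
    unfolding char_def by (subst integral_density) auto
  finally have *: "(\<integral>w. std_normal_density w *\<^sub>R iexp (N * y * w) \<partial>lborel) = complex_of_real (exp (- (N * y)\<^sup>2 / 2))" ..
  have sq: "sqrt (2 * pi) * sqrt (2 * pi) = 2 * pi" by simp
  have "(\<integral>\<xi>. iexp (\<xi> * y) * of_real (exp (- (\<xi> / N)\<^sup>2 / 2)) \<partial>lborel)
      = N *\<^sub>R (\<integral>w. iexp (N * w * y) * of_real (exp (- w\<^sup>2 / 2)) \<partial>lborel)"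
    using N by (subst lborel_integral_real_affine[of N _ 0]) auto
  also have "(\<lambda>w. iexp (N * w * y) * complex_of_real (exp (- w\<^sup>2 / 2)))
      = (\<lambda>w. of_real (sqrt (2 * pi)) * (std_normal_density w *\<^sub>R iexp (N * y * w)))"
    by (auto simp: fun_eq_iff std_normal_density_def scaleR_conv_of_real mult_ac)
  also have "(\<integral>w. of_real (sqrt (2 * pi)) * (std_normal_density w *\<^sub>R iexp (N * y * w)) \<partial>lborel)
      = of_real (sqrt (2 * pi)) * complex_of_real (exp (- (N * y)\<^sup>2 / 2))"
    by (subst integral_mult_right_zero) (simp only: *)
  also have "N *\<^sub>R (of_real (sqrt (2 * pi)) * complex_of_real (exp (- (N * y)\<^sup>2 / 2)))
      = complex_of_real (N * (sqrt (2 * pi) * exp (- (N * y)\<^sup>2 / 2)))"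
    by (simp add: scaleR_conv_of_real)
  also have "N * (sqrt (2 * pi) * exp (- (N * y)\<^sup>2 / 2)) = 2 * pi * (N * std_normal_density (N * y))"
    using sq by (simp add: std_normal_density_def field_simps)
  finally show ?thesis .
qed

lemma fourier_measurable [measurable]:
  assumes [measurable]: "\<phi> \<in> borel_measurable borel"
  shows "fourier \<phi> \<in> borel_measurable borel"
  unfolding fourier_def by measurable

lemma norm_fourier_le:
  assumes "integrable lborel \<phi>"
  shows "cmod (fourier \<phi> \<xi>) \<le> (\<integral>t. \<bar>\<phi> t\<bar> \<partial>lborel)"
proof -
  have "cmod (fourier \<phi> \<xi>) \<le> (\<integral>t. cmod (complex_of_real (\<phi> t) * exp (- (\<i> * of_real (\<xi> * t)))) \<partial>lborel)"
    unfolding fourier_def by (rule integral_norm_bound)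
  then show ?thesis by (simp add: norm_mult)
qed

lemma integrable_gaussian:
  assumes N: "0 < N"
  shows "integrable lborel (\<lambda>\<xi>. exp (- (\<xi> / N)\<^sup>2 / 2) :: real)"
proof -
  have "integrable lborel (\<lambda>\<xi>. sqrt (2 * pi) * std_normal_density (0 + (1 / N) * \<xi>))"
    using N by (intro integrable_mult_right lborel_integrable_real_affine integrable_normal_density) auto
  then show ?thesis by (simp add: std_normal_density_def)
qed

text \<open>The Gaussian factor makes the double integral absolutely convergent, so the order of
  integration can be exchanged.\<close>
lemma fourier_gaussian_sum:
  assumes int: "integrable lborel \<phi>" and N: "0 < N"
  shows "(\<integral>\<xi>. fourier \<phi> \<xi> * iexp (\<xi> * x) * of_real (exp (- (\<xi> / N)\<^sup>2 / 2)) \<partial>lborel)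
    = of_real (2 * pi * (\<integral>t. \<phi> t * (N * std_normal_density (N * (x - t))) \<partial>lborel))"
proof -
  have [measurable]: "\<phi> \<in> borel_measurable borel"
    using borel_measurable_integrable[OF int] by simp
  define F where "F t \<xi> = complex_of_real (\<phi> t) * (iexp (\<xi> * (x - t)) * of_real (exp (- (\<xi> / N)\<^sup>2 / 2)))" for t \<xi>
  have norm_F: "norm (F t \<xi>) = \<bar>\<phi> t\<bar> * exp (- (\<xi> / N)\<^sup>2 / 2)" for t \<xi>
    by (simp add: F_def norm_mult)
  have [measurable]: "case_prod F \<in> borel_measurable (lborel \<Otimes>\<^sub>M lborel)"
    unfolding F_def by measurable
  have "integrable (lborel \<Otimes>\<^sub>M lborel) (case_prod F)"
  proof (rule lborel_pair.Fubini_integrable)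
    show "integrable lborel (\<lambda>t. \<integral>\<xi>. norm (case (t, \<xi>) of (t, \<xi>) \<Rightarrow> F t \<xi>) \<partial>lborel)"
      using int by (simp add: norm_F)
    have "integrable lborel (F t)" for t
    proof (rule Bochner_Integration.integrable_bound)
      show "integrable lborel (\<lambda>\<xi>. \<bar>\<phi> t\<bar> * exp (- (\<xi> / N)\<^sup>2 / 2))"
        using integrable_gaussian[OF N] by simp
      show "F t \<in> borel_measurable lborel" unfolding F_def by measurable
      show "AE \<xi> in lborel. norm (F t \<xi>) \<le> norm (\<bar>\<phi> t\<bar> * exp (- (\<xi> / N)\<^sup>2 / 2))"
        unfolding norm_F by simp
    qed
    then show "AE t in lborel. integrable lborel (\<lambda>\<xi>. case (t, \<xi>) of (t, \<xi>) \<Rightarrow> F t \<xi>)" by simp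
  qed simp
  from lborel_pair.Fubini_integral[OF this]
  have swap: "(\<integral>\<xi>. (\<integral>t. F t \<xi> \<partial>lborel) \<partial>lborel) = (\<integral>t. (\<integral>\<xi>. F t \<xi> \<partial>lborel) \<partial>lborel)" .
  have inner1: "(\<integral>t. F t \<xi> \<partial>lborel) = fourier \<phi> \<xi> * iexp (\<xi> * x) * of_real (exp (- (\<xi> / N)\<^sup>2 / 2))" for \<xi>
  proof -
    have "F t \<xi> = (complex_of_real (\<phi> t) * exp (- (\<i> * of_real (\<xi> * t)))) * (iexp (\<xi> * x) * of_real (exp (- (\<xi> / N)\<^sup>2 / 2)))" for t
      by (simp add: F_def right_diff_distrib exp_diff exp_minus field_simps)
    then have "(\<integral>t. F t \<xi> \<partial>lborel) =
        (\<integral>t. (complex_of_real (\<phi> t) * exp (- (\<i> * of_real (\<xi> * t)))) * (iexp (\<xi> * x) * of_real (exp (- (\<xi> / N)\<^sup>2 / 2))) \<partial>lborel)"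
      by (rule Bochner_Integration.integral_cong[OF refl])
    also have "\<dots> = fourier \<phi> \<xi> * (iexp (\<xi> * x) * of_real (exp (- (\<xi> / N)\<^sup>2 / 2)))"
      unfolding fourier_def by (rule integral_mult_left_zero)
    finally show ?thesis by (simp only: mult.assoc)
  qed
  have inner2: "(\<integral>\<xi>. F t \<xi> \<partial>lborel) = complex_of_real (2 * pi * (\<phi> t * (N * std_normal_density (N * (x - t)))))" for t
    unfolding F_def by (subst integral_mult_right_zero, subst gaussian_fourier_integral[OF N]) simp
  show ?thesis
    using swap unfolding inner1 inner2 integral_complex_of_real integral_mult_right_zero .
qed

lemma wide_gaussian_tendsto_1: "(\<lambda>n. exp (- (\<xi> / real (Suc n))\<^sup>2 / 2)) \<longlonglongrightarrow> 1"
proof -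
  have "(\<lambda>n. \<xi> / real (Suc n)) \<longlonglongrightarrow> 0" by real_asymp
  then have "(\<lambda>n. exp (- (\<xi> / real (Suc n))\<^sup>2 / 2)) \<longlonglongrightarrow> exp (- 0\<^sup>2 / 2)"
    by (intro tendsto_intros) auto
  then show ?thesis by simp
qed

text \<open>The Gaussian means of a non-negative transform increase to its integral as the Gaussians
  widen. By \<open>fourier_gaussian_sum\<close> they are \<open>2 * pi\<close> times the mollifications of \<open>\<phi>\<close> at \<open>0\<close>, which
  converge to \<open>\<phi> 0\<close>; monotone convergence gives integrability.\<close>
lemma nonneg_fourier_integrable:
  assumes int: "integrable lborel \<phi>" and cont: "isCont \<phi> 0"
    and nonneg: "\<And>\<xi>. fourier \<phi> \<xi> \<in> \<real>\<^sub>\<ge>\<^sub>0"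
  shows "integrable lborel (fourier \<phi>)"
proof -
  have [measurable]: "\<phi> \<in> borel_measurable borel"
    using borel_measurable_integrable[OF int] by simp
  have re: "fourier \<phi> \<xi> = of_real (Re (fourier \<phi> \<xi>))" "0 \<le> Re (fourier \<phi> \<xi>)" for \<xi>
    using nonneg[of \<xi>] by (auto simp: complex_nonneg_Reals_iff complex_eq_iff)
  define f where "f n \<xi> = Re (fourier \<phi> \<xi>) * exp (- (\<xi> / real (Suc n))\<^sup>2 / 2)" for n \<xi>
  have "integrable lborel (\<lambda>\<xi>. Re (fourier \<phi> \<xi>))"
  proof (rule integrable_monotone_convergence)
    show "integrable lborel (f n)" for n
    proof -
      have "integrable lborel (\<lambda>\<xi>. exp (- (\<xi> / real (Suc n))\<^sup>2 / 2) * Re (fourier \<phi> \<xi>))"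
      proof (rule integrable_mult_bounded[OF integrable_gaussian])
        show "norm (Re (fourier \<phi> \<xi>)) \<le> (\<integral>t. \<bar>\<phi> t\<bar> \<partial>lborel)" for \<xi>
          using abs_Re_le_cmod[of "fourier \<phi> \<xi>"] norm_fourier_le[OF int, of \<xi>] by simp
      qed auto
      then show ?thesis by (simp add: f_def[abs_def] mult.commute)
    qed
    show "AE \<xi> in lborel. incseq (\<lambda>n. f n \<xi>)"
    proof (intro AE_I2 incseq_SucI)
      fix \<xi> n
      have "\<bar>\<xi> / real (Suc (Suc n))\<bar> \<le> \<bar>\<xi> / real (Suc n)\<bar>"
        by (simp add: abs_divide divide_left_mono)
      then have "(\<xi> / real (Suc (Suc n)))\<^sup>2 \<le> (\<xi> / real (Suc n))\<^sup>2"
        by (simp only: abs_le_square_iff)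
      then show "f n \<xi> \<le> f (Suc n) \<xi>" using re(2) by (simp add: f_def mult_left_mono)
    qed
    show "AE \<xi> in lborel. (\<lambda>n. f n \<xi>) \<longlonglongrightarrow> Re (fourier \<phi> \<xi>)"
    proof (rule AE_I2)
      fix \<xi>
      have "(\<lambda>n. exp (- (\<xi> / real (Suc n))\<^sup>2 / 2)) \<longlonglongrightarrow> 1" by (rule wide_gaussian_tendsto_1)
      from tendsto_mult_left[OF this, of "Re (fourier \<phi> \<xi>)"]
      show "(\<lambda>n. f n \<xi>) \<longlonglongrightarrow> Re (fourier \<phi> \<xi>)" by (simp add: f_def)
    qed
    have "(\<integral>\<xi>. f n \<xi> \<partial>lborel) = 2 * pi * (\<integral>t. \<phi> t * (real (Suc n) * std_normal_density (real (Suc n) * (0 - t))) \<partial>lborel)" for n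
    proof -
      have "complex_of_real (f n \<xi>) = fourier \<phi> \<xi> * iexp (\<xi> * 0) * of_real (exp (- (\<xi> / real (Suc n))\<^sup>2 / 2))" for \<xi>
        unfolding f_def by (subst (2) re(1)) simp
      then have "complex_of_real (\<integral>\<xi>. f n \<xi> \<partial>lborel)
          = (\<integral>\<xi>. fourier \<phi> \<xi> * iexp (\<xi> * 0) * of_real (exp (- (\<xi> / real (Suc n))\<^sup>2 / 2)) \<partial>lborel)"
        by (simp only: integral_complex_of_real[symmetric])
      also have "\<dots> = complex_of_real (2 * pi * (\<integral>t. \<phi> t * (real (Suc n) * std_normal_density (real (Suc n) * (0 - t))) \<partial>lborel))"
        by (rule fourier_gaussian_sum[OF int]) simp
      finally show ?thesis by (simp only: of_real_eq_iff)
    qed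
    then show "(\<lambda>n. \<integral>\<xi>. f n \<xi> \<partial>lborel) \<longlonglongrightarrow> 2 * pi * \<phi> 0"
      using tendsto_mult_left[OF gaussian_mollification[OF int cont], of "2 * pi"] by simp
  qed auto
  then have "integrable lborel (\<lambda>\<xi>. complex_of_real (Re (fourier \<phi> \<xi>)))" by simp
  then show ?thesis using re(1) by simp
qed

lemma fourier_inversion:
  assumes int: "integrable lborel \<phi>" and cont: "isCont \<phi> x"
    and intF: "integrable lborel (fourier \<phi>)"
  shows "complex_of_real (\<phi> x) = (\<integral>\<xi>. fourier \<phi> \<xi> / of_real (2 * pi) * iexp (\<xi> * x) \<partial>lborel)"
proof -
  have [measurable]: "\<phi> \<in> borel_measurable borel"
    using borel_measurable_integrable[OF int] by simp
  let ?G = "\<lambda>n \<xi>. fourier \<phi> \<xi> * iexp (\<xi> * x) * of_real (exp (- (\<xi> / real (Suc n))\<^sup>2 / 2))"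
  have lim1: "(\<lambda>n. \<integral>\<xi>. ?G n \<xi> \<partial>lborel) \<longlonglongrightarrow> (\<integral>\<xi>. fourier \<phi> \<xi> * iexp (\<xi> * x) \<partial>lborel)"
  proof (rule integral_dominated_convergence[where w = "\<lambda>\<xi>. cmod (fourier \<phi> \<xi>)"])
    show "AE \<xi> in lborel. (\<lambda>n. ?G n \<xi>) \<longlonglongrightarrow> fourier \<phi> \<xi> * iexp (\<xi> * x)"
    proof (rule AE_I2)
      fix \<xi>
      have "(\<lambda>n. exp (- (\<xi> / real (Suc n))\<^sup>2 / 2)) \<longlonglongrightarrow> 1" by (rule wide_gaussian_tendsto_1)
      from tendsto_mult_left[OF tendsto_of_real[OF this], of "fourier \<phi> \<xi> * iexp (\<xi> * x)"]
      show "(\<lambda>n. ?G n \<xi>) \<longlonglongrightarrow> fourier \<phi> \<xi> * iexp (\<xi> * x)" by simp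
    qed
    show "AE \<xi> in lborel. norm (?G n \<xi>) \<le> cmod (fourier \<phi> \<xi>)" for n
      by (intro AE_I2) (simp add: norm_mult mult_left_le)
  qed (use intF in auto)
  have "(\<integral>\<xi>. ?G n \<xi> \<partial>lborel) =
      complex_of_real (2 * pi * (\<integral>t. \<phi> t * (real (Suc n) * std_normal_density (real (Suc n) * (x - t))) \<partial>lborel))" for n
    by (rule fourier_gaussian_sum[OF int]) simp
  moreover have "(\<lambda>n. complex_of_real (2 * pi * (\<integral>t. \<phi> t * (real (Suc n) * std_normal_density (real (Suc n) * (x - t))) \<partial>lborel)))
      \<longlonglongrightarrow> complex_of_real (2 * pi * \<phi> x)"
    by (intro tendsto_of_real tendsto_mult_left gaussian_mollification int cont)
  ultimately have "(\<integral>\<xi>. fourier \<phi> \<xi> * iexp (\<xi> * x) \<partial>lborel) = complex_of_real (2 * pi * \<phi> x)"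
    using LIMSEQ_unique[OF lim1] by simp
  moreover have "(\<integral>\<xi>. fourier \<phi> \<xi> / of_real (2 * pi) * iexp (\<xi> * x) \<partial>lborel) =
      (\<integral>\<xi>. fourier \<phi> \<xi> * iexp (\<xi> * x) / of_real (2 * pi) \<partial>lborel)"
    by simp
  ultimately show ?thesis by (simp only: integral_divide_zero) simp
qed

section \<open>Functions with positive Fourier transform\<close>

text \<open>The Fourier transform of the indicator of \<open>[-h,h]\<close>. The value at \<open>0\<close> is the
  continuous extension; it keeps the identities below valid for all frequencies.\<close>
definition box_transform :: "real \<Rightarrow> real \<Rightarrow> real" where
  "box_transform h \<xi> = (if \<xi> = 0 then 2 * h else 2 * sin (\<xi> * h) / \<xi>)"

lemma box_transform_measurable [measurable]: "box_transform h \<in> borel_measurable borel"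
  unfolding box_transform_def[abs_def] by measurable

text \<open>A symmetric difference is the box average of the derivative.\<close>
lemma iexp_diff_box_transform:
  "iexp (\<xi> * h) - iexp (- (\<xi> * h)) = \<i> * of_real \<xi> * of_real (box_transform h \<xi>)"
  by (auto simp: box_transform_def complex_eq_iff Re_exp Im_exp)

lemma box_transform_integral:
  assumes "0 \<le> h"
  shows "(LINT u:{-h..h}|lborel. iexp (\<xi> * u)) = of_real (box_transform h \<xi>)"
proof (cases "\<xi> = 0")
  case True
  then show ?thesis
    using assms by (simp add: box_transform_def set_lebesgue_integral_def scaleR_conv_of_real)
next
  case False
  have "(LINT u:{-h..h}|lborel. iexp (\<xi> * u)) = iexp (\<xi> * h) / (\<i> * \<xi>) - iexp (\<xi> * (- h)) / (\<i> * \<xi>)"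
    unfolding set_lebesgue_integral_def
  proof (rule integral_FTC_atLeastAtMost)
    fix u :: real
    have "((\<lambda>z. exp (c * z) / c) has_field_derivative exp (c * of_real u)) (at (of_real u))"
      if "c \<noteq> 0" for c :: complex
      using that by (auto intro!: derivative_eq_intros)
    from this[of "\<i> * \<xi>"]
    have "((\<lambda>z. exp (\<i> * (of_real \<xi> * z)) / (\<i> * \<xi>)) has_field_derivative iexp (\<xi> * u)) (at (of_real u))"
      using False by (simp add: mult.assoc)
    then have "((\<lambda>v. exp (\<i> * (of_real \<xi> * of_real v)) / (\<i> * \<xi>)) has_vector_derivative iexp (\<xi> * u)) (at u within {-h..h})"
      by (rule has_vector_derivative_real_field)
    then show "((\<lambda>u. iexp (\<xi> * u) / (\<i> * \<xi>)) has_vector_derivative iexp (\<xi> * u)) (at u within {-h..h})"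
      by simp
  qed (use assms in \<open>auto intro!: continuous_intros\<close>)
  also have "\<dots> = (iexp (\<xi> * h) - iexp (- (\<xi> * h))) / (\<i> * \<xi>)"
    by (simp add: diff_divide_distrib)
  also have "\<dots> = of_real (box_transform h \<xi>)"
    unfolding iexp_diff_box_transform using False by simp
  finally show ?thesis .
qed

lemma abs_box_transform_le:
  assumes "0 \<le> h"
  shows "\<bar>box_transform h \<xi>\<bar> \<le> 2 * h" "\<bar>\<xi> * box_transform h \<xi>\<bar> \<le> 2"
proof -
  show "\<bar>box_transform h \<xi>\<bar> \<le> 2 * h"
  proof (cases "\<xi> = 0")
    case False
    have "\<bar>sin (\<xi> * h)\<bar> \<le> \<bar>\<xi>\<bar> * h"
      using abs_sin_x_le_abs_x[of "\<xi> * h"] assms by (simp add: abs_mult)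
    then show ?thesis
      using False by (simp add: box_transform_def abs_mult field_simps)
  qed (use assms in \<open>simp add: box_transform_def\<close>)
  show "\<bar>\<xi> * box_transform h \<xi>\<bar> \<le> 2"
    using abs_sin_le_one[of "\<xi> * h"] by (simp add: box_transform_def abs_mult)
qed

lemma box_average:
  fixes f :: "real \<Rightarrow> complex"
  assumes int: "integrable lborel f" and h: "0 \<le> h"
  shows "(LINT u:{-h..h}|lborel. (\<integral>\<xi>. f \<xi> * iexp (\<xi> * (x + u)) \<partial>lborel))
    = (\<integral>\<xi>. f \<xi> * of_real (box_transform h \<xi>) * iexp (\<xi> * x) \<partial>lborel)"
proof -
  have [measurable]: "f \<in> borel_measurable borel"
    using borel_measurable_integrable[OF int] by simp
  define F where "F \<xi> u = f \<xi> * iexp (\<xi> * x) * (indicator {-h..h} u *\<^sub>R iexp (\<xi> * u))" for \<xi> u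
  have norm_F: "norm (F \<xi> u) = norm (f \<xi>) * indicator {-h..h} u" for \<xi> u
    by (simp add: F_def norm_mult)
  have [measurable]: "case_prod F \<in> borel_measurable (lborel \<Otimes>\<^sub>M lborel)"
    unfolding F_def by measurable
  have ind: "integrable lborel (indicator {-h..h} :: real \<Rightarrow> real)"
    using h by (simp add: integrable_indicator_iff)
  have "integrable (lborel \<Otimes>\<^sub>M lborel) (case_prod F)"
  proof (rule lborel_pair.Fubini_integrable)
    show "integrable lborel (\<lambda>\<xi>. \<integral>u. norm (case (\<xi>, u) of (\<xi>, u) \<Rightarrow> F \<xi> u) \<partial>lborel)"
      using int by (simp add: norm_F)
    have "integrable lborel (F \<xi>)" for \<xi>
    proof (rule Bochner_Integration.integrable_bound)
      show "integrable lborel (\<lambda>u. norm (f \<xi>) * indicator {-h..h} u)" using ind by simp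
      show "F \<xi> \<in> borel_measurable lborel" unfolding F_def by measurable
      show "AE u in lborel. norm (F \<xi> u) \<le> norm (norm (f \<xi>) * indicator {-h..h} u)"
        unfolding norm_F by simp
    qed
    then show "AE \<xi> in lborel. integrable lborel (\<lambda>u. case (\<xi>, u) of (\<xi>, u) \<Rightarrow> F \<xi> u)" by simp
  qed simp
  from lborel_pair.Fubini_integral[OF this]
  have swap: "(\<integral>u. (\<integral>\<xi>. F \<xi> u \<partial>lborel) \<partial>lborel) = (\<integral>\<xi>. (\<integral>u. F \<xi> u \<partial>lborel) \<partial>lborel)" .
  have inner1: "(\<integral>\<xi>. F \<xi> u \<partial>lborel) = indicator {-h..h} u *\<^sub>R (\<integral>\<xi>. f \<xi> * iexp (\<xi> * (x + u)) \<partial>lborel)" for u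
  proof -
    have "F \<xi> u = indicator {-h..h} u *\<^sub>R (f \<xi> * iexp (\<xi> * (x + u)))" for \<xi>
      by (simp add: F_def distrib_left exp_add)
    then show ?thesis by simp
  qed
  have inner2: "(\<integral>u. F \<xi> u \<partial>lborel) = f \<xi> * of_real (box_transform h \<xi>) * iexp (\<xi> * x)" for \<xi>
    unfolding F_def integral_mult_right_zero
    using box_transform_integral[OF h, of \<xi>] by (simp add: set_lebesgue_integral_def mult_ac)
  show ?thesis
    using swap unfolding inner1 inner2 set_lebesgue_integral_def .
qed

lemma cnj_measurable [measurable]: "cnj \<in> borel_measurable borel"
  by (intro borel_measurable_continuous_onI continuous_intros)

text \<open>The transform of the unit mass at \<open>a\<close>; masses at \<open>\<plusminus>\<infinity>\<close>, the outer ends of the unbounded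
  cells, contribute nothing. Complex frequencies are admitted with a view to analytic continuation.\<close>
definition point_transform :: "ereal \<Rightarrow> complex \<Rightarrow> complex" where
  "point_transform a z = (if \<bar>a\<bar> = \<infinity> then 0 else exp (- (\<i> * z * of_real (real_of_ereal a))))"

text \<open>The transform of the derivative of a cell: of the difference of the two end masses for a
  proper interval, and of the derivative of the unit mass for a double knot.\<close>
definition cell_transform :: "ereal \<Rightarrow> ereal \<Rightarrow> complex \<Rightarrow> complex" where
  "cell_transform a b z =
     (if a = b then \<i> * z * point_transform a z else point_transform a z - point_transform b z)"

lemma holomorphic_point_transform [holomorphic_intros]: "point_transform a holomorphic_on S"
  unfolding point_transform_def[abs_def]
  by (cases "\<bar>a\<bar> = \<infinity>") (auto intro!: holomorphic_intros)

lemma holomorphic_cell_transform [holomorphic_intros]: "cell_transform a b holomorphic_on S"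
  unfolding cell_transform_def[abs_def]
  by (cases "a = b") (auto intro!: holomorphic_intros)

lemma point_transform_measurable [measurable]:
  "(\<lambda>\<xi>. point_transform a (complex_of_real \<xi>)) \<in> borel_measurable borel"
  unfolding point_transform_def by measurable

lemma cell_transform_measurable [measurable]:
  "(\<lambda>\<xi>. cell_transform a b (complex_of_real \<xi>)) \<in> borel_measurable borel"
  unfolding cell_transform_def by measurable

lemma norm_point_transform_le: "norm (point_transform a (complex_of_real \<xi>)) \<le> 1"
  by (simp add: point_transform_def)

text \<open>The transform of a double knot grows linearly; the box factor compensates that growth.\<close>
lemma norm_box_cell_transform_le:
  assumes h: "0 \<le> h"
  shows "norm (of_real (box_transform h \<xi>) * cell_transform a b (of_real \<xi>)) \<le> 4 * h + 2"
proof (cases "a = b")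
  case True
  have "\<bar>\<xi> * box_transform h \<xi>\<bar> * norm (point_transform a (complex_of_real \<xi>)) \<le> 2 * 1"
    by (intro mult_mono abs_box_transform_le(2)[OF h] norm_point_transform_le) auto
  then show ?thesis
    using True h by (simp add: cell_transform_def norm_mult abs_mult mult_ac)
next
  case False
  have "norm (cell_transform a b (of_real \<xi>)) \<le> 2"
    using False norm_triangle_ineq4[of "point_transform a (complex_of_real \<xi>)" "point_transform b (complex_of_real \<xi>)"]
      norm_point_transform_le[of a \<xi>] norm_point_transform_le[of b \<xi>]
    by (simp add: cell_transform_def)
  then have "\<bar>box_transform h \<xi>\<bar> * norm (cell_transform a b (of_real \<xi>)) \<le> (2 * h) * 2"
    using h by (intro mult_mono abs_box_transform_le(1)) auto
  then show ?thesis by (simp add: norm_mult)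
qed

lemma primitive_diff:
  assumes int: "integrable lborel \<phi>" and h: "0 \<le> h"
  shows "primitive \<phi> (ereal (x + h)) - primitive \<phi> (ereal (x - h)) = (LINT u:{-h..h}|lborel. \<phi> (x + u))"
proof -
  have i: "integrable lborel (\<lambda>t. indicator {t. ereal t < e} t *\<^sub>R \<phi> t)" for e
    using int by (intro integrable_mult_indicator) auto
  have [measurable]: "\<phi> \<in> borel_measurable borel"
    using borel_measurable_integrable[OF int] by simp
  have "primitive \<phi> (ereal (x + h)) - primitive \<phi> (ereal (x - h))
      = (\<integral>t. indicator {t. ereal t < ereal (x + h)} t *\<^sub>R \<phi> t - indicator {t. ereal t < ereal (x - h)} t *\<^sub>R \<phi> t \<partial>lborel)"
    unfolding primitive_def set_lebesgue_integral_def by (rule Bochner_Integration.integral_diff[OF i i, symmetric])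
  also have "\<dots> = (\<integral>t. indicator {-h..h} (t - x) *\<^sub>R \<phi> t \<partial>lborel)"
  proof (rule integral_cong_AE)
    have "AE t in lborel. t \<noteq> x + h" by (rule AE_lborel_singleton)
    then show "AE t in lborel. indicator {t. ereal t < ereal (x + h)} t *\<^sub>R \<phi> t - indicator {t. ereal t < ereal (x - h)} t *\<^sub>R \<phi> t
        = indicator {-h..h} (t - x) *\<^sub>R \<phi> t"
      by eventually_elim (use h in \<open>auto simp: indicator_def\<close>)
  qed (use i in \<open>auto intro!: borel_measurable_diff\<close>)
  also have "\<dots> = (\<integral>u. indicator {-h..h} u *\<^sub>R \<phi> (x + u) \<partial>lborel)"
    by (subst lborel_integral_real_affine[of 1 _ x]) simp_all
  finally show ?thesis by (simp add: set_lebesgue_integral_def)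
qed

text \<open>The symmetric difference of a cell function is \<open>\<phi>\<close> convolved with the box and with the derivative
  of the cell; here \<open>q\<close> is the transform of \<open>\<phi>\<close> divided by \<open>2 * pi\<close>. In contrast to the cell function itself, the
  difference has an integrable transform also when the cell is unbounded.\<close>
lemma Delta_difference_transform:
  assumes int: "integrable lborel \<phi>"
    and inv: "\<And>x. complex_of_real (\<phi> x) = (\<integral>\<xi>. q \<xi> * iexp (\<xi> * x) \<partial>lborel)"
    and q: "integrable lborel q" and h: "0 \<le> h"
    and ab: "a \<le> b" "a = b \<Longrightarrow> \<bar>a\<bar> \<noteq> \<infinity>"
  shows "complex_of_real (Delta \<phi> (x + h) a b - Delta \<phi> (x - h) a b)
    = (\<integral>\<xi>. q \<xi> * (of_real (box_transform h \<xi>) * cell_transform a b (of_real \<xi>)) * iexp (\<xi> * x) \<partial>lborel)"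
proof -
  have qe: "integrable lborel (\<lambda>\<xi>. q \<xi> * iexp (\<xi> * y))" for y
    by (rule integrable_mult_bounded[OF q, where B = 1]) auto
  show ?thesis
  proof (cases "a = b")
    case True
    then obtain r where r: "a = ereal r" "b = ereal r" using ab(2) by (cases a) auto
    have "complex_of_real (Delta \<phi> (x + h) a b - Delta \<phi> (x - h) a b)
        = complex_of_real (\<phi> (x + h - r)) - complex_of_real (\<phi> (x - h - r))"
      using r by (simp add: Delta_def)
    also have "\<dots> = (\<integral>\<xi>. q \<xi> * iexp (\<xi> * (x + h - r)) - q \<xi> * iexp (\<xi> * (x - h - r)) \<partial>lborel)"
      unfolding inv by (rule Bochner_Integration.integral_diff[OF qe qe, symmetric])
    also have "\<dots> = (\<integral>\<xi>. q \<xi> * (of_real (box_transform h \<xi>) * cell_transform a b (of_real \<xi>)) * iexp (\<xi> * x) \<partial>lborel)"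
    proof (rule Bochner_Integration.integral_cong[OF refl])
      fix \<xi>
      have e1: "iexp (\<xi> * (x + h - r)) = iexp (\<xi> * h) * (exp (- (\<i> * \<xi> * r)) * iexp (\<xi> * x))"
        and e2: "iexp (\<xi> * (x - h - r)) = iexp (- (\<xi> * h)) * (exp (- (\<i> * \<xi> * r)) * iexp (\<xi> * x))"
        by (simp_all add: exp_add[symmetric] algebra_simps)
      have "q \<xi> * iexp (\<xi> * (x + h - r)) - q \<xi> * iexp (\<xi> * (x - h - r))
          = q \<xi> * ((iexp (\<xi> * h) - iexp (- (\<xi> * h))) * (exp (- (\<i> * \<xi> * r)) * iexp (\<xi> * x)))"
        unfolding e1 e2 by (simp only: left_diff_distrib right_diff_distrib)
      also have "\<dots> = q \<xi> * (of_real (box_transform h \<xi>) * cell_transform a b (of_real \<xi>)) * iexp (\<xi> * x)"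
        unfolding iexp_diff_box_transform
        using r by (simp add: cell_transform_def point_transform_def mult_ac)
      finally show "q \<xi> * iexp (\<xi> * (x + h - r)) - q \<xi> * iexp (\<xi> * (x - h - r))
          = q \<xi> * (of_real (box_transform h \<xi>) * cell_transform a b (of_real \<xi>)) * iexp (\<xi> * x)" .
    qed
    finally show ?thesis .
  next
    case False
    have prim: "complex_of_real (primitive \<phi> (ereal (x + h) - e) - primitive \<phi> (ereal (x - h) - e))
        = (\<integral>\<xi>. q \<xi> * (of_real (box_transform h \<xi>) * point_transform e (of_real \<xi>)) * iexp (\<xi> * x) \<partial>lborel)" for e
    proof (cases e)
      case (real r)
      have "complex_of_real (primitive \<phi> (ereal (x + h) - e) - primitive \<phi> (ereal (x - h) - e))
          = complex_of_real (LINT u:{-h..h}|lborel. \<phi> (x - r + u))"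
        unfolding primitive_diff[OF int h, of "x - r", symmetric] by (simp add: real algebra_simps)
      also have "\<dots> = (LINT u:{-h..h}|lborel. (\<integral>\<xi>. q \<xi> * iexp (\<xi> * (x - r + u)) \<partial>lborel))"
        unfolding inv[symmetric] by (rule set_integral_complex_of_real[symmetric])
      also have "\<dots> = (\<integral>\<xi>. q \<xi> * of_real (box_transform h \<xi>) * iexp (\<xi> * (x - r)) \<partial>lborel)"
        by (rule box_average[OF q h])
      also have "\<dots> = (\<integral>\<xi>. q \<xi> * (of_real (box_transform h \<xi>) * point_transform e (of_real \<xi>)) * iexp (\<xi> * x) \<partial>lborel)"
      proof (rule Bochner_Integration.integral_cong[OF refl])
        fix \<xi>
        have "iexp (\<xi> * (x - r)) = exp (- (\<i> * \<xi> * r)) * iexp (\<xi> * x)"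
          by (simp add: exp_add[symmetric] algebra_simps)
        then show "q \<xi> * of_real (box_transform h \<xi>) * iexp (\<xi> * (x - r))
            = q \<xi> * (of_real (box_transform h \<xi>) * point_transform e (of_real \<xi>)) * iexp (\<xi> * x)"
          by (simp add: real point_transform_def)
      qed
      finally show ?thesis .
    qed (simp_all add: point_transform_def)
    have pint: "integrable lborel (\<lambda>\<xi>. q \<xi> * (of_real (box_transform h \<xi>) * point_transform e (of_real \<xi>)) * iexp (\<xi> * x))" for e
      unfolding mult.assoc
    proof (rule integrable_mult_bounded[OF q, where B = "2 * h"])
      show "norm (of_real (box_transform h \<xi>) * (point_transform e (of_real \<xi>) * iexp (\<xi> * x))) \<le> 2 * h" for \<xi>
        using mult_mono[OF abs_box_transform_le(1)[OF h, of \<xi>] norm_point_transform_le[of e \<xi>]] h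
        by (simp add: norm_mult)
    qed simp
    have lt: "a < b" using ab(1) False by simp
    have "complex_of_real (Delta \<phi> (x + h) a b - Delta \<phi> (x - h) a b)
        = complex_of_real (primitive \<phi> (ereal (x + h) - a) - primitive \<phi> (ereal (x - h) - a))
        - complex_of_real (primitive \<phi> (ereal (x + h) - b) - primitive \<phi> (ereal (x - h) - b))"
      unfolding Delta_eq_primitive[OF int lt] by simp
    also have "\<dots> = (\<integral>\<xi>. q \<xi> * (of_real (box_transform h \<xi>) * point_transform a (of_real \<xi>)) * iexp (\<xi> * x)
        - q \<xi> * (of_real (box_transform h \<xi>) * point_transform b (of_real \<xi>)) * iexp (\<xi> * x) \<partial>lborel)"
      unfolding prim by (rule Bochner_Integration.integral_diff[OF pint pint, symmetric])
    also have "\<dots> = (\<integral>\<xi>. q \<xi> * (of_real (box_transform h \<xi>) * cell_transform a b (of_real \<xi>)) * iexp (\<xi> * x) \<partial>lborel)"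
      using False by (intro Bochner_Integration.integral_cong refl) (simp add: cell_transform_def algebra_simps)
    finally show ?thesis .
  qed
qed

text \<open>Multiplying \<open>f\<close> by the conjugate of the box times a cell transform amounts to applying to the
  inverse transform of \<open>f\<close> a functional that only involves its values within distance \<open>h\<close> of the
  end points of the cell: averages over \<open>[r - h, r + h]\<close>, or a difference of the values at \<open>r - h\<close> and \<open>r + h\<close>.\<close>
lemma vanishing_transform_pairing:
  fixes f :: "real \<Rightarrow> complex"
  assumes f: "integrable lborel f" and h: "0 \<le> h"
    and ab: "a = b \<Longrightarrow> \<bar>a\<bar> \<noteq> \<infinity>"
    and zero: "\<And>r u. ereal r \<in> {a, b} \<Longrightarrow> u \<in> {-h..h} \<Longrightarrow> (\<integral>\<xi>. f \<xi> * iexp (\<xi> * (r + u)) \<partial>lborel) = 0"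
  shows "(\<integral>\<xi>. f \<xi> * cnj (of_real (box_transform h \<xi>) * cell_transform a b (of_real \<xi>)) \<partial>lborel) = 0"
proof -
  have fe: "integrable lborel (\<lambda>\<xi>. f \<xi> * iexp (\<xi> * y))" for y
    by (rule integrable_mult_bounded[OF f, where B = 1]) auto
  have cnj_exp: "cnj (exp (- (\<i> * complex_of_real \<xi> * complex_of_real r))) = iexp (\<xi> * r)" for \<xi> r
    by (simp add: exp_cnj mult_ac)
  show ?thesis
  proof (cases "a = b")
    case True
    then obtain r where r: "a = ereal r" "b = ereal r" using ab by (cases a) auto
    have "f \<xi> * cnj (of_real (box_transform h \<xi>) * cell_transform a b (of_real \<xi>))
        = f \<xi> * iexp (\<xi> * (r + - h)) - f \<xi> * iexp (\<xi> * (r + h))" for \<xi>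
    proof -
      have "cnj (of_real (box_transform h \<xi>) * cell_transform a b (of_real \<xi>))
          = - (\<i> * of_real \<xi> * of_real (box_transform h \<xi>)) * iexp (\<xi> * r)"
        using r cnj_exp[of \<xi> r] by (simp add: cell_transform_def point_transform_def mult_ac)
      also have "\<dots> = (iexp (- (\<xi> * h)) - iexp (\<xi> * h)) * iexp (\<xi> * r)"
        unfolding iexp_diff_box_transform[symmetric] by simp
      also have "\<dots> = iexp (\<xi> * (r + - h)) - iexp (\<xi> * (r + h))"
        by (simp add: left_diff_distrib exp_add[symmetric] algebra_simps)
      finally show ?thesis by (simp only: right_diff_distrib)
    qed
    then have "(\<integral>\<xi>. f \<xi> * cnj (of_real (box_transform h \<xi>) * cell_transform a b (of_real \<xi>)) \<partial>lborel)
        = (\<integral>\<xi>. f \<xi> * iexp (\<xi> * (r + - h)) - f \<xi> * iexp (\<xi> * (r + h)) \<partial>lborel)"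
      by (intro Bochner_Integration.integral_cong refl)
    also have "\<dots> = (\<integral>\<xi>. f \<xi> * iexp (\<xi> * (r + - h)) \<partial>lborel) - (\<integral>\<xi>. f \<xi> * iexp (\<xi> * (r + h)) \<partial>lborel)"
      by (rule Bochner_Integration.integral_diff[OF fe fe])
    also have "\<dots> = 0"
      using zero[of r "-h"] zero[of r h] r h by (simp del: of_real_add of_real_mult)
    finally show ?thesis .
  next
    case False
    have one: "(\<integral>\<xi>. f \<xi> * cnj (of_real (box_transform h \<xi>) * point_transform e (of_real \<xi>)) \<partial>lborel) = 0"
      if e: "e \<in> {a, b}" for e
    proof (cases e)
      case (real r)
      have "(\<integral>\<xi>. f \<xi> * cnj (of_real (box_transform h \<xi>) * point_transform e (of_real \<xi>)) \<partial>lborel)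
          = (\<integral>\<xi>. f \<xi> * of_real (box_transform h \<xi>) * iexp (\<xi> * r) \<partial>lborel)"
        using cnj_exp by (intro Bochner_Integration.integral_cong refl) (simp add: real point_transform_def)
      also have "\<dots> = (LINT u:{-h..h}|lborel. (\<integral>\<xi>. f \<xi> * iexp (\<xi> * (r + u)) \<partial>lborel))"
        by (rule box_average[OF f h, symmetric])
      also have "\<dots> = (LINT u:{-h..h}|lborel. 0)"
        using zero e unfolding real by (intro set_lebesgue_integral_cong) auto
      finally show ?thesis by simp
    qed (simp_all add: point_transform_def)
    have pint: "integrable lborel (\<lambda>\<xi>. f \<xi> * cnj (of_real (box_transform h \<xi>) * point_transform e (of_real \<xi>)))" for e
    proof (rule integrable_mult_bounded[OF f, where B = "2 * h"])
      show "norm (cnj (of_real (box_transform h \<xi>) * point_transform e (of_real \<xi>))) \<le> 2 * h" for \<xi>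
        using mult_mono[OF abs_box_transform_le(1)[OF h, of \<xi>] norm_point_transform_le[of e \<xi>]] h
        by (simp add: norm_mult)
    qed simp
    have "(\<integral>\<xi>. f \<xi> * cnj (of_real (box_transform h \<xi>) * cell_transform a b (of_real \<xi>)) \<partial>lborel)
        = (\<integral>\<xi>. f \<xi> * cnj (of_real (box_transform h \<xi>) * point_transform a (of_real \<xi>))
          - f \<xi> * cnj (of_real (box_transform h \<xi>) * point_transform b (of_real \<xi>)) \<partial>lborel)"
      using False by (intro Bochner_Integration.integral_cong refl) (simp add: cell_transform_def algebra_simps)
    also have "\<dots> = 0"
      by (subst Bochner_Integration.integral_diff[OF pint pint]) (simp only: one insertI1 insertI2 diff_self)
    finally show ?thesis .
  qed
qed

text \<open>On the imaginary axis the transforms become real exponentials.\<close>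
definition exp_weight :: "ereal \<Rightarrow> real \<Rightarrow> real" where
  "exp_weight a t = (if \<bar>a\<bar> = \<infinity> then 0 else exp (- (t * real_of_ereal a)))"

definition exp_cell :: "ereal \<Rightarrow> ereal \<Rightarrow> real \<Rightarrow> real" where
  "exp_cell a b t = (if a = b then t * exp_weight a t else exp_weight a t - exp_weight b t)"

lemma cell_transform_imaginary:
  "cell_transform a b (- \<i> * of_real t) = of_real (exp_cell a b t)"
proof -
  have "point_transform e (- \<i> * of_real t) = of_real (exp_weight e t)" for e
    by (simp add: point_transform_def exp_weight_def exp_of_real[symmetric] mult.assoc[symmetric])
  then show ?thesis by (simp add: cell_transform_def exp_cell_def)
qed

lemma exp_weight_ratio_tendsto_0:
  assumes "ereal s < a"
  shows "((\<lambda>t. exp_weight a t / exp (- (t * s))) \<longlongrightarrow> 0) at_top"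
    and "((\<lambda>t. t * exp_weight a t / exp (- (t * s))) \<longlongrightarrow> 0) at_top"
proof -
  have "((\<lambda>t. exp_weight a t / exp (- (t * s))) \<longlongrightarrow> 0) at_top \<and>
      ((\<lambda>t. t * exp_weight a t / exp (- (t * s))) \<longlongrightarrow> 0) at_top"
  proof (cases a)
    case (real r)
    define d where "d = r - s"
    have d: "0 < d" using assms real by (simp add: d_def)
    have eq: "exp_weight a t / exp (- (t * s)) = exp (- (t * d))" for t
      by (simp add: exp_weight_def real d_def exp_diff[symmetric] algebra_simps)
    have "((\<lambda>t. exp (- (t * d))) \<longlongrightarrow> 0) at_top" "((\<lambda>t. t * exp (- (t * d))) \<longlongrightarrow> 0) at_top"
      using d by real_asymp+
    then show ?thesis by (simp add: eq flip: times_divide_eq_right)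
  qed (use assms in \<open>auto simp: exp_weight_def\<close>)
  then show "((\<lambda>t. exp_weight a t / exp (- (t * s))) \<longlongrightarrow> 0) at_top"
    and "((\<lambda>t. t * exp_weight a t / exp (- (t * s))) \<longlongrightarrow> 0) at_top" by auto
qed

lemma exp_cell_ratio_tendsto_0:
  assumes "ereal s < a" "a \<le> b"
  shows "((\<lambda>t. exp_cell a b t / exp (- (t * s))) \<longlongrightarrow> 0) at_top"
proof (cases "a = b")
  case True
  then show ?thesis using exp_weight_ratio_tendsto_0(2)[OF assms(1)] by (simp add: exp_cell_def)
next
  case False
  have "ereal s < b" using assms by simp
  from tendsto_diff[OF exp_weight_ratio_tendsto_0(1)[OF assms(1)] exp_weight_ratio_tendsto_0(1)[OF this]]
  show ?thesis using False by (simp add: exp_cell_def diff_divide_distrib)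
qed

text \<open>As \<open>t \<rightarrow> \<infinity>\<close>, the exponential of the leftmost knot dominates, and at a double knot the factor \<open>t\<close> makes
  the point mass dominate the cell that follows. The terms of the proper cells alone telescope to
  \<open>0\<close>, so a common value \<open>c 0\<close> cannot be detected; it is subtracted first. This removes the cell \<open>0\<close> from
  the relation and leaves a triangular family.\<close>
lemma exp_cell_coefficients:
  assumes p: "admissible_partition k \<tau>"
    and zero: "\<And>t. (\<Sum>j\<le>k. c j * exp_cell (\<tau> j) (\<tau> (Suc j)) t) = 0"
    and j: "j \<le> k"
  shows "c j = (if \<tau> j = \<tau> (Suc j) then 0 else c 0)"
proof -
  define f where "f i = exp_cell (\<tau> i) (\<tau> (Suc i))" for i
  define s where "s i = real_of_ereal (\<tau> i)" for i
  have ends: "\<tau> 0 = -\<infinity>" "\<tau> (Suc k) = \<infinity>"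
    using p by (auto simp: admissible_partition_def)
  have s: "\<tau> i = ereal (s i)" if "i \<in> {1..k}" for i
  proof -
    have "1 \<le> i" "i \<le> k" using that by auto
    obtain r where "\<tau> i = ereal r" by (rule partition_inner[OF p \<open>1 \<le> i\<close> \<open>i \<le> k\<close>])
    then show ?thesis by (simp add: s_def)
  qed
  have w: "exp_weight (\<tau> i) t = exp (- (t * s i))" if "i \<in> {1..k}" for i t
    using s[OF that] by (simp add: exp_weight_def)
  have nd0: "\<tau> 0 \<noteq> \<tau> (Suc 0)" using partition_double(1)[OF p, of 0] by auto
  \<comment> \<open>subtracting \<open>c 0\<close> times the telescoping sum over the proper cells\<close>
  define d where "d i = (if \<tau> i = \<tau> (Suc i) then c i else c i - c 0)" for i
  have sum_d: "(\<Sum>i\<in>{1..k}. d i * f i t) = 0" for t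
  proof -
    have d_f: "d i * f i t = c i * f i t - c 0 * (exp_weight (\<tau> i) t - exp_weight (\<tau> (Suc i)) t)" for i
      by (simp add: d_def f_def exp_cell_def algebra_simps)
    have "(\<Sum>i\<le>k. d i * f i t) = 0 - c 0 * (\<Sum>i\<le>k. exp_weight (\<tau> i) t - exp_weight (\<tau> (Suc i)) t)"
      unfolding d_f sum_subtractf sum_distrib_left[symmetric] using zero[of t] by (simp add: f_def)
    also have "\<dots> = 0" unfolding sum_telescope[of "\<lambda>i. exp_weight (\<tau> i) t"] by (simp add: ends exp_weight_def)
    also have "(\<Sum>i\<le>k. d i * f i t) = (\<Sum>i\<in>{1..k}. d i * f i t)"
      using nd0 by (intro sum.mono_neutral_right) (auto simp: d_def Suc_le_eq)
    finally show ?thesis .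
  qed
  have next_le: "\<tau> (Suc j) \<le> \<tau> i" if "j < i" "i \<le> k" for i j
    using that by (intro partition_mono[OF p]) auto
  have f_ratio: "((\<lambda>t. f j t / exp (- (t * s j))) \<longlongrightarrow> 1) at_top"
    if "j \<in> {1..k}" "\<tau> j \<noteq> \<tau> (Suc j)" for j
  proof -
    have "\<tau> j < \<tau> (Suc j)" using partition_mono_step[OF p, of j] that by simp
    then have "ereal (s j) < \<tau> (Suc j)" using s[OF that(1)] by simp
    from tendsto_diff[OF tendsto_const exp_weight_ratio_tendsto_0(1)[OF this]]
    have "((\<lambda>t. 1 - exp_weight (\<tau> (Suc j)) t / exp (- (t * s j))) \<longlongrightarrow> 1) at_top" by simp
    then show ?thesis
      using that(2) by (simp add: f_def exp_cell_def w[OF that(1)] diff_divide_distrib)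
  qed
  have f_pos: "0 < f j t" if "j \<in> {1..k}" "0 < t" for j t
  proof (cases "\<tau> j = \<tau> (Suc j)")
    case True
    then show ?thesis using that by (simp add: f_def exp_cell_def w flip: True)
  next
    case False
    have "exp_weight (\<tau> (Suc j)) t < exp_weight (\<tau> j) t"
    proof (cases "j = k")
      case True
      then show ?thesis using that w[OF that(1)] by (simp add: ends exp_weight_def[of \<infinity>])
    next
      case False': False
      then have j': "Suc j \<in> {1..k}" using that by auto
      have "\<tau> j < \<tau> (Suc j)" using partition_mono_step[OF p, of j] that False by simp
      then show ?thesis using s[OF that(1)] s[OF j'] w[OF that(1)] w[OF j'] that(2) by simp
    qed
    then show ?thesis using False by (simp add: f_def exp_cell_def)
  qed
  have d0: "d j = 0" if "j \<in> {1..k}" for j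
  proof (rule triangular_independence[where I = "{1..k}" and F = "\<lambda>_. at_top" and f = f])
    show "\<exists>\<^sub>F t in at_top. (\<Sum>i\<in>{1..k}. d i * f i t) = 0" for j :: nat
      unfolding sum_d by simp
    show "\<forall>\<^sub>F t in at_top. f j t \<noteq> 0" if "j \<in> {1..k}" for j
      using eventually_gt_at_top[of 0] by eventually_elim (use f_pos[OF that] in force)
    fix i j assume i: "i \<in> {1..k}" and j: "j \<in> {1..k}" and ji: "j < i"
    define e where "e t = exp (- (t * s j))" for t
    have split: "\<forall>\<^sub>F t in at_top. (f i t / e t) * (e t / f j t) = f i t / f j t"
      by (simp add: e_def)
    have "\<exists>l m. ((\<lambda>t. f i t / e t) \<longlongrightarrow> l) at_top \<and> ((\<lambda>t. e t / f j t) \<longlongrightarrow> m) at_top \<and> l * m = 0"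
    proof (cases "\<tau> j = \<tau> (Suc j)")
      case False
      have "((\<lambda>t. inverse (f j t / e t)) \<longlongrightarrow> inverse 1) at_top"
        unfolding e_def by (rule tendsto_inverse[OF f_ratio[OF j False]]) simp
      then have m: "((\<lambda>t. e t / f j t) \<longlongrightarrow> 1) at_top" by simp
      have "\<tau> j < \<tau> (Suc j)" using partition_mono_step[OF p, of j] j False by simp
      then have "ereal (s j) < \<tau> i" "\<tau> i \<le> \<tau> (Suc i)"
        using next_le[OF ji] s[OF j] i partition_mono_step[OF p, of i] by auto
      from exp_cell_ratio_tendsto_0[OF this]
      have "((\<lambda>t. f i t / e t) \<longlongrightarrow> 0) at_top" unfolding f_def e_def .
      with m show ?thesis by auto
    next
      case True
      have dbl: "j < k" "\<tau> (Suc j) < \<tau> (Suc (Suc j))" using partition_double[OF p _ True] j by auto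
      have "\<forall>\<^sub>F t in at_top. 1 / t = e t / f j t"
        by (simp add: f_def exp_cell_def True w[OF j, unfolded True] e_def)
      moreover have "((\<lambda>t::real. 1 / t) \<longlongrightarrow> 0) at_top" by real_asymp
      ultimately have m: "((\<lambda>t. e t / f j t) \<longlongrightarrow> 0) at_top" using tendsto_cong by fast
      have "\<exists>l. ((\<lambda>t. f i t / e t) \<longlongrightarrow> l) at_top"
      proof (cases "i = Suc j")
        case True': True
        have "s i = s j" using True True' by (simp add: s_def)
        moreover have "\<tau> i \<noteq> \<tau> (Suc i)" using dbl True' by simp
        ultimately show ?thesis using f_ratio[OF i] unfolding e_def by auto
      next
        case False
        then have "\<tau> (Suc (Suc j)) \<le> \<tau> i" using ji i by (intro partition_mono[OF p]) auto
        then have "ereal (s j) < \<tau> i" "\<tau> i \<le> \<tau> (Suc i)"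
          using dbl True s[OF j] i partition_mono_step[OF p, of i] by auto
        from exp_cell_ratio_tendsto_0[OF this]
        have "((\<lambda>t. f i t / e t) \<longlongrightarrow> 0) at_top" unfolding f_def e_def .
        then show ?thesis by auto
      qed
      with m show ?thesis by auto
    qed
    then obtain l m where l: "((\<lambda>t. f i t / e t) \<longlongrightarrow> l) at_top" and m: "((\<lambda>t. e t / f j t) \<longlongrightarrow> m) at_top"
      and lm: "l * m = 0" by blast
    show "((\<lambda>t. f i t / f j t) \<longlongrightarrow> 0) at_top"
      using tendsto_mult[OF l m] tendsto_cong[OF split] lm by simp
  qed (use that in auto)
  show ?thesis
  proof (cases "j = 0")
    case False
    then have "d j = 0" using j by (intro d0) auto
    then show ?thesis by (simp add: d_def split: if_splits)
  qed (use nd0 in simp)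
qed

lemma continuous_AE_zero:
  fixes g :: "real \<Rightarrow> real"
  assumes cont: "continuous_on UNIV g" and ae: "AE x in lborel. x \<in> {a..b} \<longrightarrow> g x = 0" and x: "a < x" "x < b"
  shows "g x = 0"
proof (rule ccontr)
  assume "g x \<noteq> 0"
  let ?U = "{a<..<b} \<inter> g -` (- {0})"
  have "open ?U"
    by (intro open_Int open_vimage cont open_greaterThanLessThan open_Compl closed_singleton)
  moreover have "x \<in> ?U" using x \<open>g x \<noteq> 0\<close> by simp
  moreover have "AE x in lborel. x \<notin> ?U" using ae by eventually_elim auto
  then have "?U \<in> null_sets lborel" using \<open>open ?U\<close> by (subst AE_iff_null_sets) auto
  ultimately show False
    using open_not_negligible null_sets_completionI negligible_iff_null_sets by blast
qed

text \<open>With \<open>K\<close> the transform of \<open>\<mu>'\<close>, the symmetric difference \<open>g (x + h) - g (x - h)\<close> of the relation is the inverse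
  transform of \<open>q * box * K\<close>. It vanishes within distance \<open>h\<close> of every knot, because all knots have distance at least
  \<open>3 * h\<close> from \<open>0\<close> and from \<open>1\<close>. Pairing with the conjugate of \<open>box * K\<close> yields
  \<open>\<integral> q * \<bar>box * K\<bar>\<^sup>2 = 0\<close> with \<open>q > 0\<close>.\<close>
lemma positive_definite_independent:
  assumes cont: "continuous_on UNIV \<phi>" and int: "integrable lborel \<phi>"
    and nonneg: "\<And>\<xi>. fourier \<phi> \<xi> \<in> \<real>\<^sub>\<ge>\<^sub>0" and nz: "\<And>\<xi>. fourier \<phi> \<xi> \<noteq> 0"
    and k: "1 \<le> k" and p: "admissible_partition k \<tau>"
    and ae: "AE x in lborel. x \<in> {0..1} \<longrightarrow> (\<Sum>j\<in>{0..k}. c j * Delta \<phi> x (\<tau> j) (\<tau> (j + 1))) = 0"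
    and j: "j \<le> k"
  shows "c j = 0"
proof -
  have cont_at: "isCont \<phi> x" for x using cont by (simp add: continuous_on_eq_continuous_at)
  define q where "q \<xi> = fourier \<phi> \<xi> / of_real (2 * pi)" for \<xi>
  have intF: "integrable lborel (fourier \<phi>)" by (rule nonneg_fourier_integrable[OF int cont_at nonneg])
  have q: "integrable lborel q" unfolding q_def using intF by simp
  have inv: "complex_of_real (\<phi> x) = (\<integral>\<xi>. q \<xi> * iexp (\<xi> * x) \<partial>lborel)" for x
    unfolding q_def by (rule fourier_inversion[OF int cont_at intF])
  have q_pos: "q \<xi> = of_real (Re (q \<xi>))" "0 < Re (q \<xi>)" for \<xi>
    using nonneg[of \<xi>] nz[of \<xi>]
    by (auto simp: q_def complex_nonneg_Reals_iff complex_eq_iff less_le)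
  have ends: "\<tau> 0 = -\<infinity>" "\<tau> (Suc k) = \<infinity>"
    using p by (auto simp: admissible_partition_def)
  have finite_double: "\<bar>\<tau> j\<bar> \<noteq> \<infinity>" if "j \<le> k" "\<tau> j = \<tau> (Suc j)" for j
    by (rule partition_inner[OF p partition_double(1)[OF p that] that(1)]) simp
  define g where "g x = (\<Sum>j\<le>k. c j * Delta \<phi> x (\<tau> j) (\<tau> (Suc j)))" for x
  have cont_g: "continuous_on UNIV g"
    unfolding g_def
    by (intro continuous_on_sum continuous_on_mult continuous_on_const continuous_Delta int cont partition_mono_step[OF p]) auto
  have g0: "g x = 0" if "0 < x" "x < 1" for x
    by (rule continuous_AE_zero[OF cont_g _ that]) (use ae in \<open>simp add: g_def atLeast0AtMost\<close>)
  obtain t1 where t1: "\<tau> 1 = ereal t1" "0 < t1" "t1 < 1" by (rule partition_inner[OF p order.refl k])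
  obtain tk where tk: "\<tau> k = ereal tk" "0 < tk" "tk < 1" by (rule partition_inner[OF p k order.refl])
  define h where "h = min t1 (1 - tk) / 3"
  have h: "0 < h" "3 * h \<le> t1" "3 * h \<le> 1 - tk" using t1 tk by (auto simp: h_def)
  have knots: "r \<in> {3 * h..1 - 3 * h}" if "j \<le> Suc k" "\<tau> j = ereal r" for j r
  proof -
    have "j \<noteq> 0" using that(2) ends(1) by (intro notI) simp
    moreover have "j \<noteq> Suc k" using that(2) ends(2) by (intro notI) simp
    ultimately have "1 \<le> j" "j \<le> k" using that(1) by auto
    then have "ereal t1 \<le> ereal r" "ereal r \<le> ereal tk"
      unfolding t1(1)[symmetric] tk(1)[symmetric] that(2)[symmetric] by (auto intro!: partition_mono[OF p])
    then show ?thesis using h by simp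
  qed
  let ?b = "\<lambda>\<xi>. complex_of_real (box_transform h \<xi>)"
  define K where "K z = (\<Sum>j\<le>k. of_real (c j) * cell_transform (\<tau> j) (\<tau> (Suc j)) z)" for z
  have bdd: "norm (?b \<xi> * cell_transform a b (of_real \<xi>)) \<le> 4 * h + 2" for \<xi> a b
    using norm_box_cell_transform_le h by simp
  have qbk: "integrable lborel (\<lambda>\<xi>. q \<xi> * (?b \<xi> * cell_transform a b (of_real \<xi>)))" for a b
    by (rule integrable_mult_bounded[OF q _ bdd]) simp
  define f where "f \<xi> = q \<xi> * (?b \<xi> * K (of_real \<xi>))" for \<xi>
  have f_sum: "f \<xi> = (\<Sum>j\<le>k. of_real (c j) * (q \<xi> * (?b \<xi> * cell_transform (\<tau> j) (\<tau> (Suc j)) (of_real \<xi>))))" for \<xi>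
    by (simp add: f_def K_def sum_distrib_left mult_ac)
  have f: "integrable lborel f"
    unfolding f_sum[abs_def] by (intro Bochner_Integration.integrable_sum integrable_mult_right qbk)
  have f_transform: "(\<integral>\<xi>. f \<xi> * iexp (\<xi> * x) \<partial>lborel) = of_real (g (x + h) - g (x - h))" for x
  proof -
    have i: "integrable lborel (\<lambda>\<xi>. q \<xi> * (?b \<xi> * cell_transform a b (of_real \<xi>)) * iexp (\<xi> * x))" for a b
      by (rule integrable_mult_bounded[OF qbk, where B = 1]) auto
    have "(\<integral>\<xi>. f \<xi> * iexp (\<xi> * x) \<partial>lborel)
        = (\<integral>\<xi>. (\<Sum>j\<le>k. of_real (c j) * (q \<xi> * (?b \<xi> * cell_transform (\<tau> j) (\<tau> (Suc j)) (of_real \<xi>)) * iexp (\<xi> * x))) \<partial>lborel)"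
      unfolding f_sum sum_distrib_right by (simp only: mult.assoc)
    also have "\<dots> = (\<Sum>j\<le>k. of_real (c j) * (\<integral>\<xi>. q \<xi> * (?b \<xi> * cell_transform (\<tau> j) (\<tau> (Suc j)) (of_real \<xi>)) * iexp (\<xi> * x) \<partial>lborel))"
      using i by (subst Bochner_Integration.integral_sum) auto
    also have "\<dots> = (\<Sum>j\<le>k. of_real (c j) * of_real (Delta \<phi> (x + h) (\<tau> j) (\<tau> (Suc j)) - Delta \<phi> (x - h) (\<tau> j) (\<tau> (Suc j))))"
      using h by (intro sum.cong refl arg_cong2[where f = "(*)"] Delta_difference_transform[OF int inv q, symmetric]
          partition_mono_step[OF p] finite_double) auto
    also have "\<dots> = of_real (g (x + h) - g (x - h))"
      by (simp add: g_def sum_subtractf right_diff_distrib)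
    finally show ?thesis .
  qed
  have pair: "(\<integral>\<xi>. f \<xi> * cnj (?b \<xi> * cell_transform (\<tau> j) (\<tau> (Suc j)) (of_real \<xi>)) \<partial>lborel) = 0" if "j \<le> k" for j
  proof (rule vanishing_transform_pairing[OF f])
    show "\<bar>\<tau> j\<bar> \<noteq> \<infinity>" if "\<tau> j = \<tau> (Suc j)" using finite_double[OF \<open>j \<le> k\<close> that] .
    fix r u assume r: "ereal r \<in> {\<tau> j, \<tau> (Suc j)}" and u: "u \<in> {-h..h}"
    have "r \<in> {3 * h..1 - 3 * h}" using knots[of j r] knots[of "Suc j" r] r that by auto
    then have "g (r + u + h) = 0" "g (r + u - h) = 0" using u h by (auto intro!: g0)
    then show "(\<integral>\<xi>. f \<xi> * iexp (\<xi> * (r + u)) \<partial>lborel) = 0"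
      unfolding f_transform by simp
  qed (use h in simp)
  define G where "G \<xi> = Re (q \<xi>) * (norm (?b \<xi> * K (of_real \<xi>)))\<^sup>2" for \<xi>
  have G_sum: "complex_of_real (G \<xi>) = (\<Sum>j\<le>k. of_real (c j) * (f \<xi> * cnj (?b \<xi> * cell_transform (\<tau> j) (\<tau> (Suc j)) (of_real \<xi>))))" for \<xi>
  proof -
    have "complex_of_real (G \<xi>) = of_real (Re (q \<xi>)) * ((?b \<xi> * K (of_real \<xi>)) * cnj (?b \<xi> * K (of_real \<xi>)))"
      by (simp only: G_def of_real_mult complex_norm_square)
    also have "\<dots> = f \<xi> * cnj (?b \<xi> * K (of_real \<xi>))"
      unfolding q_pos(1)[symmetric] f_def by (simp only: mult.assoc)
    also have "cnj (?b \<xi> * K (of_real \<xi>)) = (\<Sum>j\<le>k. of_real (c j) * cnj (?b \<xi> * cell_transform (\<tau> j) (\<tau> (Suc j)) (of_real \<xi>)))"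
      by (simp add: K_def sum_distrib_left mult_ac)
    finally show ?thesis by (simp add: sum_distrib_left mult_ac)
  qed
  have fi: "integrable lborel (\<lambda>\<xi>. f \<xi> * cnj (?b \<xi> * cell_transform a b (of_real \<xi>)))" for a b
  proof (rule integrable_mult_bounded[OF f])
    show "norm (cnj (?b \<xi> * cell_transform a b (of_real \<xi>))) \<le> 4 * h + 2" for \<xi>
      using bdd[of \<xi> a b] by (simp only: complex_mod_cnj)
  qed simp
  have intG: "integrable lborel G"
  proof -
    have "integrable lborel (\<lambda>\<xi>. complex_of_real (G \<xi>))"
      unfolding G_sum by (intro Bochner_Integration.integrable_sum integrable_mult_right fi)
    then show ?thesis by (simp only: complex_of_real_integrable_eq)
  qed
  have "complex_of_real (\<integral>\<xi>. G \<xi> \<partial>lborel) = (\<integral>\<xi>. complex_of_real (G \<xi>) \<partial>lborel)"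
    by (rule integral_complex_of_real[symmetric])
  also have "\<dots> = (\<Sum>j\<le>k. of_real (c j) * (\<integral>\<xi>. f \<xi> * cnj (?b \<xi> * cell_transform (\<tau> j) (\<tau> (Suc j)) (of_real \<xi>)) \<partial>lborel))"
    unfolding G_sum using fi by (subst Bochner_Integration.integral_sum) auto
  also have "\<dots> = 0" by (intro sum.neutral) (simp add: pair del: complex_cnj_mult)
  finally have "(\<integral>\<xi>. G \<xi> \<partial>lborel) = 0" by (simp only: of_real_eq_0_iff)
  moreover have "0 \<le> G \<xi>" for \<xi> using q_pos(2)[of \<xi>] by (simp add: G_def)
  ultimately have G0: "AE \<xi> in lborel. G \<xi> = 0"
    using integral_nonneg_eq_0_iff_AE[OF intG] by simp
  \<comment> \<open>on \<open>[a, 2 * a]\<close> the argument \<open>\<xi> * h\<close> stays in \<open>(0, pi)\<close>, so the box factor has no zero there\<close>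
  define a where "a = pi / (3 * h)"
  have a: "0 < a" using h by (simp add: a_def)
  have "AE \<xi> in lborel. \<xi> \<in> {a..2 * a} \<longrightarrow> K (of_real \<xi>) = 0"
    using G0
  proof eventually_elim
    case (elim \<xi>)
    show ?case
    proof
      assume \<xi>: "\<xi> \<in> {a..2 * a}"
      then have pos: "0 < \<xi> * h" using a h by auto
      have "\<xi> * h \<le> 2 * a * h" using \<xi> h by (intro mult_right_mono) auto
      moreover have "2 * a * h = 2 * pi / 3" using h by (simp add: a_def)
      ultimately have "\<xi> * h < pi" using pi_gt_zero by linarith
      with pos have "0 < sin (\<xi> * h)" by (rule sin_gt_zero)
      then have "?b \<xi> \<noteq> 0" using \<xi> a by (auto simp: box_transform_def)
      then show "K (of_real \<xi>) = 0"
        using elim q_pos(2)[of \<xi>] by (simp add: G_def)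
    qed
  qed
  then have "infinite {\<xi> \<in> {a..2 * a}. K (of_real \<xi>) = 0}"
    by (rule AE_infinite) (use a in simp)
  then have "infinite (complex_of_real ` {\<xi> \<in> {a..2 * a}. K (of_real \<xi>) = 0})"
    by (subst finite_image_iff) (auto simp: inj_on_def)
  moreover have "bounded (complex_of_real ` {\<xi> \<in> {a..2 * a}. K (of_real \<xi>) = 0})"
    by (rule boundedI[where B = "2 * a"]) (use a in auto)
  ultimately obtain l where l: "l islimpt (complex_of_real ` {\<xi> \<in> {a..2 * a}. K (of_real \<xi>) = 0})"
    using bounded_infinite_imp_islimpt by blast
  have K0: "K z = 0" for z
    by (rule analytic_continuation[where S = UNIV and f = K, OF _ open_UNIV connected_UNIV subset_UNIV UNIV_I l])
       (auto simp: K_def[abs_def] intro!: holomorphic_intros)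
  have "(\<Sum>j\<le>k. c j * exp_cell (\<tau> j) (\<tau> (Suc j)) t) = 0" for t
  proof -
    have "complex_of_real (\<Sum>j\<le>k. c j * exp_cell (\<tau> j) (\<tau> (Suc j)) t) = K (- \<i> * of_real t)"
      unfolding K_def cell_transform_imaginary by simp
    then show ?thesis unfolding K0 by (simp only: of_real_eq_0_iff)
  qed
  note coeff = exp_cell_coefficients[OF p this]
  \<comment> \<open>all proper cells now carry the coefficient \<open>c 0\<close>, so the relation says \<open>c 0 * \<integral> \<phi> = 0\<close>\<close>
  have "g (1/2) = (\<Sum>j\<le>k. c 0 * (primitive \<phi> (ereal (1/2) - \<tau> j) - primitive \<phi> (ereal (1/2) - \<tau> (Suc j))))"
    unfolding g_def
  proof (rule sum.cong[OF refl])
    fix j assume "j \<in> {..k}"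
    then have j: "j \<le> k" by simp
    show "c j * Delta \<phi> (1/2) (\<tau> j) (\<tau> (Suc j)) = c 0 * (primitive \<phi> (ereal (1/2) - \<tau> j) - primitive \<phi> (ereal (1/2) - \<tau> (Suc j)))"
    proof (cases "\<tau> j = \<tau> (Suc j)")
      case False
      then have "\<tau> j < \<tau> (Suc j)" using partition_mono_step[OF p j] by simp
      then show ?thesis using coeff[OF j] False by (simp only: Delta_eq_primitive[OF int] if_False)
    qed (use coeff[OF j] in simp)
  qed
  also have "\<dots> = c 0 * (\<integral>x. \<phi> x \<partial>lborel)"
    unfolding sum_distrib_left[symmetric] sum_telescope[of "\<lambda>j. primitive \<phi> (ereal (1/2) - \<tau> j)"]
    by (simp add: ends)
  finally have "c 0 * (\<integral>x. \<phi> x \<partial>lborel) = 0" using g0[of "1/2"] by simp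
  moreover have "fourier \<phi> 0 = of_real (\<integral>x. \<phi> x \<partial>lborel)" by (simp add: fourier_def)
  then have "(\<integral>x. \<phi> x \<partial>lborel) \<noteq> 0" using nz[of 0] by auto
  ultimately have "c 0 = 0" by simp
  then show ?thesis using coeff[OF j] by simp
qed

lemma positive_definite_assumption_B:
  assumes cont: "continuous_on UNIV \<phi>" and int: "integrable lborel \<phi>"
    and nonneg: "\<And>\<xi>. fourier \<phi> \<xi> \<in> \<real>\<^sub>\<ge>\<^sub>0" and nz: "\<And>\<xi>. fourier \<phi> \<xi> \<noteq> 0"
  shows "assumption_B \<phi>"
proof (rule assumption_B_I[OF int])
  have cont_at: "isCont \<phi> x" for x using cont by (simp add: continuous_on_eq_continuous_at)
  then show "piecewise_continuous \<phi>"
    unfolding piecewise_continuous_def by (intro exI[of _ "{}"]) simp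
  have intF: "integrable lborel (fourier \<phi>)" by (rule nonneg_fourier_integrable[OF int cont_at nonneg])
  show "\<bar>\<phi> x\<bar> \<le> (\<integral>\<xi>. cmod (fourier \<phi> \<xi> / of_real (2 * pi)) \<partial>lborel)" for x
  proof -
    have "\<bar>\<phi> x\<bar> = cmod (complex_of_real (\<phi> x))" by simp
    also have "\<dots> \<le> (\<integral>\<xi>. cmod (fourier \<phi> \<xi> / of_real (2 * pi) * iexp (\<xi> * x)) \<partial>lborel)"
      unfolding fourier_inversion[OF int cont_at intF] by (rule integral_norm_bound)
    finally show ?thesis by (simp add: norm_mult norm_divide)
  qed
qed (rule positive_definite_independent[OF cont int nonneg nz])

section \<open>The three sufficient conditions\<close>

theorem theorem2p1:
  fixes \<phi> :: "real \<Rightarrow> real"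
  assumes
    "(continuous_on UNIV \<phi> \<and> \<phi> \<in> L1_space lborel \<and>
      (\<forall>x. \<phi> (- x) = \<phi> x) \<and>
      (\<forall>x. fourier \<phi> x \<in> \<real>\<^sub>\<ge>\<^sub>0) \<and>
      (\<exists>n0::nat. \<exists>C::real. n0 \<ge> 1 \<and> C > 0 \<and>
         (\<forall>x. C * inverse (1 + \<bar>x\<bar> ^ n0) \<le> cmod (fourier \<phi> x))))
     \<or>
     ((\<forall>k\<ge>1. extended_sign_regular \<phi> (k + 2)) \<and>
      integrable lborel \<phi> \<and> 0 < (\<integral>x. \<phi> x \<partial>lborel))
     \<or>
     (\<exists>p::nat. \<forall>x. \<phi> x = (if x \<in> {0..1} then x ^ p else 0))"
  shows "assumption_B \<phi>"
  using assms
proof (elim disjE conjE exE)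
  fix n0 :: nat and C :: real
  assume cont: "continuous_on UNIV \<phi>" and int: "\<phi> \<in> L1_space lborel"
    and nonneg: "\<forall>x. fourier \<phi> x \<in> \<real>\<^sub>\<ge>\<^sub>0" and C: "0 < C"
    and low: "\<forall>x. C * inverse (1 + \<bar>x\<bar> ^ n0) \<le> cmod (fourier \<phi> x)"
  have nz: "fourier \<phi> x \<noteq> 0" for x
  proof -
    have "0 < 1 + \<bar>x\<bar> ^ n0" by (simp add: add_pos_nonneg)
    then have "0 < C * inverse (1 + \<bar>x\<bar> ^ n0)" using C by simp
    also have "\<dots> \<le> cmod (fourier \<phi> x)" using low by simp
    finally show ?thesis by simp
  qed
  show ?thesis
    by (rule positive_definite_assumption_B[OF cont _ _ nz]) (use int nonneg in \<open>auto simp: L1_space_def\<close>)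
next
  assume "\<forall>k\<ge>1. extended_sign_regular \<phi> (k + 2)" "integrable lborel \<phi>" "0 < (\<integral>x. \<phi> x \<partial>lborel)"
  then show ?thesis by (intro sign_regular_assumption_B) simp_all
next
  fix p :: nat
  assume "\<forall>x. \<phi> x = (if x \<in> {0..1} then x ^ p else 0)"
  then show ?thesis by (intro truncated_power_assumption_B) simp
qed

end
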